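(* Let $K\in\mathcal{T}_h$, let $\mathbf{f}\in\mathbf{L}^2(K)$, and let boundary data $\check{\mathbf{u}}_h,\hat{\mathbf{u}}_h\in\mathbf{L}^2(\partial K)$ be given (only $\check{\mathbf{u}}_h\cdot\mathbf{n}^\perp$ and $\hat{\mathbf{u}}_h\cdot\mathbf{n}$ on $\partial K$ are used). Then there is exactly one $(\sigma_h,\phi_h,\mathbf{u}_h)\in\mathcal{P}_k(K)\times\mathcal{P}_k(K)\times\boldsymbol{\mathcal{P}}_k(K)$ such that, for all $(\chi,\varphi,\mathbf{z})\in\mathcal{P}_k(K)\times\mathcal{P}_k(K)\times\boldsymbol{\mathcal{P}}_k(K)$, $$(\sigma_h,\chi)_K-(\mathbf{u}_h,\mathbf{curl}\,\chi)_K+\langle\check{\mathbf{u}}_h\cdot\mathbf{n}^\perp,\chi\rangle_{\partial K}=0,$$ $$(\phi_h,\varphi)_K-(\mathbf{u}_h,\nabla\varphi)_K+\langle\hat{\mathbf{u}}_h\cdot\mathbf{n},\varphi\rangle_{\partial K}=0,$$ $$(\sigma_h,\operatorname{rot}\mathbf{z})_K+\langle\check\sigma_h,\mathbf{z}\cdot\mathbf{n}^\perp\rangle_{\partial K}-(\phi_h,\operatorname{div}\mathbf{z})_K+\langle\hat\phi_h,\mathbf{z}\cdot\mathbf{n}\rangle_{\partial K}=(\mathbf{f},\mathbf{z})_K,$$ where on $\partial K$ $$\check\sigma_h:=\sigma_h+\alpha^{-1}(\mathbf{u}_h-\check{\mathbf{u}}_h)\cdot\mathbf{n}^\perp,\qquad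 \hat\phi_h:=\phi_h+\tau^{-1}(\mathbf{u}_h-\hat{\mathbf{u}}_h)\cdot\mathbf{n}.$$
   Context: $K\in\mathcal{T}_h$ is a polygonal element of a mesh of a bounded, polygonal, simply connected Lipschitz domain $\Omega\subset\mathbb{R}^2$, with outward unit normal $\mathbf{n}$ on $\partial K$. The mesh is quasi-uniform with mesh size $h$; in particular each $K$ is star-shaped with respect to a ball of diameter at least $\rho h$, with $\rho>0$ fixed. $(a,b)^\perp:=(b,-a)$. For scalar $\varphi$ and vector $\mathbf{z}=(z_1,z_2)$: $\nabla\varphi=(\partial_x\varphi,\partial_y\varphi)$, $\mathbf{curl}\,\varphi=(\partial_y\varphi,-\partial_x\varphi)$, $\operatorname{div}\mathbf{z}=\partial_xz_1+\partial_yz_2$, $\operatorname{rot}\mathbf{z}=\partial_xz_2-\partial_yz_1$. $k\ge0$ is an integer, $\mathcal{P}_k(K)$ is the space of polynomials of degree $\le k$ on $K$, and $\boldsymbol{\mathcal{P}}_k(K)=\mathcal{P}_k(K)^2$. $(\cdot,\cdot)_K$ and $\langle\cdot,\cdot\rangle_{\partial K}$ are the $L^2$ inner products on $K$ and $\partial K$ (scalar or vector), and $\mathbf{L}^2=(L^2)^2$. $\alpha>0$ and $\tau>0$ are constant stabilization parameters. *)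

theory Defs
  imports "HOL-Analysis.Analysis"
begin

section \<open>Vector calculus in the plane\<close>

definition perp :: "real^2 \<Rightarrow> real^2" where
  "perp v = vector [v $ 2, - v $ 1]"

definition partial_deriv :: "2 \<Rightarrow> (real^2 \<Rightarrow> real) \<Rightarrow> real^2 \<Rightarrow> real" where
  "partial_deriv i p x = frechet_derivative p (at x) (axis i 1)"

definition grad :: "(real^2 \<Rightarrow> real) \<Rightarrow> real^2 \<Rightarrow> real^2" where
  "grad p x = vector [partial_deriv 1 p x, partial_deriv 2 p x]"

definition curl :: "(real^2 \<Rightarrow> real) \<Rightarrow> real^2 \<Rightarrow> real^2" where
  "curl p x = vector [partial_deriv 2 p x, - partial_deriv 1 p x]"

definition divergence :: "(real^2 \<Rightarrow> real^2) \<Rightarrow> real^2 \<Rightarrow> real" where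
  "divergence z x = partial_deriv 1 (\<lambda>y. z y $ 1) x + partial_deriv 2 (\<lambda>y. z y $ 2) x"

definition rot :: "(real^2 \<Rightarrow> real^2) \<Rightarrow> real^2 \<Rightarrow> real" where
  "rot z x = partial_deriv 1 (\<lambda>y. z y $ 2) x - partial_deriv 2 (\<lambda>y. z y $ 1) x"


section \<open>Polynomial spaces\<close>

text \<open>Polynomials are represented by functions on the whole plane; since an element has
  nonempty interior, such a function is determined by its restriction to the element, and its
  trace on the boundary is obtained by evaluation.\<close>

definition poly_space :: "nat \<Rightarrow> (real^2 \<Rightarrow> real) set" where
  "poly_space k =
     {p. \<exists>c :: nat \<Rightarrow> nat \<Rightarrow> real. \<forall>x. p x = (\<Sum>i\<le>k. \<Sum>j\<le>k - i. c i j * (x $ 1) ^ i * (x $ 2) ^ j)}"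

definition vec_poly_space :: "nat \<Rightarrow> (real^2 \<Rightarrow> real^2) set" where
  "vec_poly_space k = {u. \<forall>i. (\<lambda>x. u x $ i) \<in> poly_space k}"


section \<open>Polygons and meshes\<close>

fun polygonal_path :: "(real^2) list \<Rightarrow> real \<Rightarrow> real^2" where
  "polygonal_path [] = linepath 0 0"
| "polygonal_path [a] = linepath a a"
| "polygonal_path [a, b] = linepath a b"
| "polygonal_path (a # b # c # vs) = linepath a b +++ polygonal_path (b # c # vs)"

text \<open>\<open>K\<close> is the open region enclosed by the simple closed polygon with vertices \<open>vs\<close>, listed in
  either orientation. Consecutive edges may be collinear.\<close>

definition polygon_with_vertices :: "(real^2) list \<Rightarrow> (real^2) set \<Rightarrow> bool" where
  "polygon_with_vertices vs K \<longleftrightarrow>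
     length vs \<ge> 3 \<and>
     simple_path (polygonal_path (vs @ [hd vs])) \<and>
     K = inside (path_image (polygonal_path (vs @ [hd vs])))"

definition lipschitz_boundary :: "(real^2) set \<Rightarrow> bool" where
  "lipschitz_boundary \<Omega> \<longleftrightarrow>
     (\<forall>p \<in> frontier \<Omega>. \<exists>a b g L \<epsilon>. norm a = 1 \<and> norm b = 1 \<and> a \<bullet> b = 0 \<and>
        L-lipschitz_on UNIV (g :: real \<Rightarrow> real) \<and> \<epsilon> > 0 \<and>
        (\<forall>x \<in> ball p \<epsilon>. x \<in> \<Omega> \<longleftrightarrow> g (x \<bullet> a) < x \<bullet> b))"

definition polygonal_boundary :: "(real^2) set \<Rightarrow> bool" where
  "polygonal_boundary \<Omega> \<longleftrightarrow>
     (\<exists>E. finite E \<and> frontier \<Omega> = (\<Union>(a, b) \<in> E. closed_segment a b))"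

definition admissible_domain :: "(real^2) set \<Rightarrow> bool" where
  "admissible_domain \<Omega> \<longleftrightarrow>
     open \<Omega> \<and> connected \<Omega> \<and> \<Omega> \<noteq> {} \<and> bounded \<Omega> \<and> simply_connected \<Omega> \<and>
     polygonal_boundary \<Omega> \<and> lipschitz_boundary \<Omega>"

definition star_shaped_wrt_ball :: "(real^2) set \<Rightarrow> real^2 \<Rightarrow> real \<Rightarrow> bool" where
  "star_shaped_wrt_ball K c r \<longleftrightarrow>
     ball c r \<subseteq> K \<and> (\<forall>y \<in> ball c r. \<forall>x \<in> K. closed_segment y x \<subseteq> K)"

text \<open>Elements are open. Quasi-uniformity is the last conjunct: it forces the diameter of every
  element to lie between \<open>\<rho> * h\<close> and \<open>h\<close>. Hanging nodes are allowed.\<close>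

definition quasi_uniform_mesh ::
  "(real^2) set \<Rightarrow> (real^2) set set \<Rightarrow> real \<Rightarrow> real \<Rightarrow> bool" where
  "quasi_uniform_mesh \<Omega> T h \<rho> \<longleftrightarrow>
     finite T \<and> T \<noteq> {} \<and>
     (\<forall>K \<in> T. \<exists>vs. polygon_with_vertices vs K) \<and>
     pairwise disjnt T \<and>
     closure \<Omega> = (\<Union>K \<in> T. closure K) \<and>
     h = Max (diameter ` T) \<and>
     (\<forall>K \<in> T. \<exists>c r. 2 * r \<ge> \<rho> * h \<and> star_shaped_wrt_ball K c r)"

text \<open>At a boundary point that is not a corner, a polygon coincides locally with a half-plane,
  whose outward unit normal is taken. The value at the finitely many corners is unspecified and
  irrelevant to integrals along the boundary.\<close>

definition outward_normal :: "(real^2) set \<Rightarrow> real^2 \<Rightarrow> real^2" where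
  "outward_normal K x =
     (THE n. norm n = 1 \<and> (\<exists>\<epsilon>>0. \<forall>y \<in> ball x \<epsilon>. y \<in> K \<longleftrightarrow> (y - x) \<bullet> n < 0))"


section \<open>Square-integrable functions and inner products\<close>

definition L2_fun :: "(real^2) set \<Rightarrow> (real^2 \<Rightarrow> real^2) \<Rightarrow> bool" where
  "L2_fun K f \<longleftrightarrow> f \<in> borel_measurable (lebesgue_on K) \<and>
     integrable (lebesgue_on K) (\<lambda>x. (norm (f x))\<^sup>2)"

definition L2_inner :: "(real^2) set \<Rightarrow> (real^2 \<Rightarrow> 'b::real_inner) \<Rightarrow> (real^2 \<Rightarrow> 'b) \<Rightarrow> real" where
  "L2_inner K f g = integral\<^sup>L (lebesgue_on K) (\<lambda>x. f x \<bullet> g x)"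

definition edge :: "(real^2) list \<Rightarrow> nat \<Rightarrow> real \<Rightarrow> real^2" where
  "edge vs i = linepath (vs ! i) (vs ! (Suc i mod length vs))"

definition edge_length :: "(real^2) list \<Rightarrow> nat \<Rightarrow> real" where
  "edge_length vs i = dist (vs ! i) (vs ! (Suc i mod length vs))"

text \<open>The boundary carries the arc length measure. Each edge is parametrized over \<open>{0..1}\<close>
  with constant speed \<open>edge_length vs i\<close>.\<close>

definition L2_boundary_fun :: "(real^2) list \<Rightarrow> (real^2 \<Rightarrow> real^2) \<Rightarrow> bool" where
  "L2_boundary_fun vs g \<longleftrightarrow> (\<forall>i < length vs.
     (\<lambda>t. g (edge vs i t)) \<in> borel_measurable (lebesgue_on {0..1}) \<and>
     integrable (lebesgue_on {0..1}) (\<lambda>t. (norm (g (edge vs i t)))\<^sup>2))"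

definition L2_boundary_inner ::
  "(real^2) list \<Rightarrow> (real^2 \<Rightarrow> real) \<Rightarrow> (real^2 \<Rightarrow> real) \<Rightarrow> real" where
  "L2_boundary_inner vs f g = (\<Sum>i < length vs.
     edge_length vs i * integral\<^sup>L (lebesgue_on {0..1}) (\<lambda>t. f (edge vs i t) * g (edge vs i t)))"

end

theory Submission
  imports Defs
begin

text \<open>
  The problem is a square linear system, so it suffices that the homogeneous system has only the
  trivial solution. Testing with the solution itself and integrating by parts gives
  \<open>(\<sigma>, \<sigma>) + (\<phi>, \<phi>)\<close> plus the weighted squares of both boundary components of \<open>u\<close> equal to \<open>0\<close>.
  Hence \<open>\<sigma> = \<phi> = 0\<close> and \<open>u\<close> vanishes on the boundary; the first two equations then give
  \<open>rot u = divergence u = 0\<close>, so the components of \<open>u\<close> are harmonic with zero boundary values.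

  The divergence theorem is obtained from star-shapedness without cancelling inner edges of a
  triangulation. For every centre \<open>c\<close>, the element is up to a null set the disjoint union of the
  cones over its edges, and on a cone the theorem for the field \<open>g x *\<^sub>R (x - c)\<close> is a
  one-dimensional statement along rays. Subtracting this for two centres leaves the theorem for
  \<open>g\<close> times a constant vector, and the centres fill a ball.
\<close>

section \<open>Linear systems\<close>

text \<open>The field \<open>g x *\<^sub>R (x - c)\<close> is tangent to every line through
  \<open>c\<close>, so the sides shared by neighbouring cones carry no flux; this is why nothing has
  to cancel. Its divergence is \<open>2 * g x\<close> plus the derivative of \<open>g\<close> along
  \<open>x - c\<close>. The first summand does not depend on \<open>c\<close> and disappears when
  two centres are compared. The vertex list may have either orientation, so the outward direction of
  a normal must come from the position of a centre, through the sign of a determinant. The normal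
  has no specified value at corners. Boundary statements that involve it therefore go through a
  representative on each open edge, and vanishing at corners is recovered by continuity. Harmonicity
  rests on \<open>rot u\<close> and \<open>divergence u\<close> being admissible test functions of
  the same degree bound. Polynomials are functions on the whole plane, so uniqueness also needs that
  a polynomial vanishing on the open set \<open>K\<close> vanishes identically.\<close>

lemma underdetermined_system:
  fixes M :: "'i \<Rightarrow> 'j \<Rightarrow> real"
  assumes "finite I" "finite J" "card I < card J"
  shows "\<exists>x. (\<exists>j\<in>J. x j \<noteq> 0) \<and> (\<forall>i\<in>I. (\<Sum>j\<in>J. M i j * x j) = 0)"
  using assms
proof (induction I arbitrary: J M rule: finite_induct)
  case empty
  then have "J \<noteq> {}" by auto
  then show ?case by (intro exI[of _ "\<lambda>_. 1"]) auto
next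
  case (insert i I)
  show ?case
  proof (cases "\<forall>j\<in>J. M i j = 0")
    case True
    have "card I < card J" using insert by auto
    from insert.IH[OF insert.prems(1) this, of M] True show ?thesis by auto
  next
    case False
    then obtain p where p: "p \<in> J" "M i p \<noteq> 0" by auto
    define J' where "J' = J - {p}"
    have J': "finite J'" "p \<notin> J'" "J = insert p J'" using p insert.prems by (auto simp: J'_def)
    have "card I < card J'" using insert J' by auto
    \<comment> \<open>Gaussian elimination: these are the coefficients left after the unknown
      \<open>p\<close> is removed from row \<open>a\<close> by means of row \<open>i\<close>. The
      value of \<open>x p\<close> is recovered from row \<open>i\<close> afterwards.\<close>
    from insert.IH[OF J'(1) this, of "\<lambda>a j. M a j - M a p * M i j / M i p"] obtain y where
      y: "\<exists>j\<in>J'. y j \<noteq> 0" "\<And>a. a \<in> I \<Longrightarrow> (\<Sum>j\<in>J'. (M a j - M a p * M i j / M i p) * y j) = 0"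
      by blast
    define s where "s = (\<Sum>j\<in>J'. M i j * y j)"
    define x where "x = y(p := - s / M i p)"
    have sumx: "(\<Sum>j\<in>J. M a j * x j) = (\<Sum>j\<in>J'. M a j * y j) - M a p * s / M i p" for a
    proof -
      have "(\<Sum>j\<in>J'. M a j * x j) = (\<Sum>j\<in>J'. M a j * y j)"
        using J'(2) by (intro sum.cong) (auto simp: x_def)
      then show ?thesis using J' by (simp add: x_def)
    qed
    have "(\<Sum>j\<in>J. M a j * x j) = 0" if "a \<in> I" for a
    proof -
      have "(\<Sum>j\<in>J'. M a j * y j) - M a p / M i p * s = 0"
        using y(2)[OF that] unfolding s_def
        by (simp add: algebra_simps sum_subtractf sum_distrib_left)
      then show ?thesis unfolding sumx by simp
    qed
    moreover have "(\<Sum>j\<in>J. M i j * x j) = 0"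
      unfolding sumx using p by (simp add: s_def)
    moreover have "\<exists>j\<in>J. x j \<noteq> 0" using y(1) J' by (auto simp: x_def)
    ultimately show ?thesis by auto
  qed
qed

text \<open>Injectivity gives solvability by homogenisation. The right-hand side becomes one more
  column \<open>- b\<close> with unknown \<open>x None\<close>, so there are more unknowns than
  equations and a nontrivial solution exists. Its entry \<open>x None\<close> cannot be
  \<open>0\<close>, for then injectivity would make the solution trivial; dividing by it solves the
  system.\<close>

lemma square_system:
  fixes M :: "'i \<Rightarrow> 'i \<Rightarrow> real"
  assumes fin: "finite I"
    and inj: "\<And>x. (\<And>i. i \<in> I \<Longrightarrow> (\<Sum>j\<in>I. M i j * x j) = 0) \<Longrightarrow> (\<And>j. j \<in> I \<Longrightarrow> x j = 0)"
  shows "\<exists>x. \<forall>i\<in>I. (\<Sum>j\<in>I. M i j * x j) = b i"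
proof -
  define J where "J = insert None (Some ` I)"
  define N where "N = (\<lambda>i j. case j of None \<Rightarrow> - b i | Some j \<Rightarrow> M i j)"
  have J: "finite J" "card I < card J"
    using fin by (auto simp: J_def card_image)
  obtain x where x: "\<exists>j\<in>J. x j \<noteq> 0" "\<And>i. i \<in> I \<Longrightarrow> (\<Sum>j\<in>J. N i j * x j) = 0"
    using underdetermined_system[OF fin J, of N] by blast
  have *: "(\<Sum>j\<in>I. M i j * x (Some j)) = b i * x None" if "i \<in> I" for i
  proof -
    have "(\<Sum>j\<in>J. N i j * x j) = - b i * x None + (\<Sum>j\<in>Some ` I. N i j * x j)"
      using fin by (simp add: J_def N_def)
    also have "(\<Sum>j\<in>Some ` I. N i j * x j) = (\<Sum>j\<in>I. M i j * x (Some j))"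
      by (subst sum.reindex) (auto simp: N_def)
    finally show ?thesis using x(2)[OF that] by simp
  qed
  have "x None \<noteq> 0"
  proof
    assume "x None = 0"
    then have "x (Some j) = 0" if "j \<in> I" for j
      using inj[of "\<lambda>j. x (Some j)"] * that by auto
    then show False using x(1) \<open>x None = 0\<close> by (auto simp: J_def)
  qed
  then show ?thesis
    using * by (intro exI[of _ "\<lambda>j. x (Some j) / x None"]) (simp add: sum_divide_distrib[symmetric])
qed


section \<open>Polynomials in two variables\<close>

definition mon :: "nat \<times> nat \<Rightarrow> real^2 \<Rightarrow> real" where
  "mon m x = (x $ 1) ^ fst m * (x $ 2) ^ snd m"

definition mon_idx :: "nat \<Rightarrow> (nat \<times> nat) set" where
  "mon_idx k = (SIGMA i:{..k}. {..k - i})"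

lemma finite_mon_idx [simp]: "finite (mon_idx k)"
  by (simp add: mon_idx_def)

lemma mem_mon_idx: "m \<in> mon_idx k \<longleftrightarrow> fst m + snd m \<le> k"
  by (cases m) (auto simp: mon_idx_def)

lemma poly_space_iff:
  "p \<in> poly_space k \<longleftrightarrow> (\<exists>c. \<forall>x. p x = (\<Sum>m\<in>mon_idx k. c m * mon m x))"
proof -
  have *: "(\<Sum>i\<le>k. \<Sum>j\<le>k - i. c i j * (x $ 1) ^ i * (x $ 2) ^ j)
      = (\<Sum>m\<in>mon_idx k. case_prod c m * mon m x)" for c and x :: "real^2"
    by (simp add: mon_idx_def sum.Sigma mon_def case_prod_beta mult.assoc)
  show ?thesis
  proof
    assume "p \<in> poly_space k"
    then show "\<exists>c. \<forall>x. p x = (\<Sum>m\<in>mon_idx k. c m * mon m x)"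
      unfolding poly_space_def mem_Collect_eq * by blast
  next
    assume "\<exists>c. \<forall>x. p x = (\<Sum>m\<in>mon_idx k. c m * mon m x)"
    then obtain c where "\<forall>x. p x = (\<Sum>m\<in>mon_idx k. c m * mon m x)" by blast
    then show "p \<in> poly_space k"
      unfolding poly_space_def mem_Collect_eq *
      by (intro exI[of _ "curry c"]) simp
  qed
qed

lemma mon_in_poly_space: "fst m + snd m \<le> k \<Longrightarrow> mon m \<in> poly_space k"
  unfolding poly_space_iff
  by (intro exI[of _ "\<lambda>n. if n = m then 1 else 0"])
     (auto simp: mem_mon_idx if_distrib[of "\<lambda>c. c * _"] sum.delta cong: if_cong)

lemma poly_space_add:
  assumes "p \<in> poly_space k" "q \<in> poly_space k"
  shows "(\<lambda>x. p x + q x) \<in> poly_space k"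
proof -
  obtain c d where "\<forall>x. p x = (\<Sum>m\<in>mon_idx k. c m * mon m x)"
    "\<forall>x. q x = (\<Sum>m\<in>mon_idx k. d m * mon m x)"
    using assms unfolding poly_space_iff by blast
  then show ?thesis unfolding poly_space_iff
    by (intro exI[of _ "\<lambda>m. c m + d m"]) (simp add: sum.distrib algebra_simps)
qed

lemma poly_space_cmult:
  assumes "p \<in> poly_space k"
  shows "(\<lambda>x. a * p x) \<in> poly_space k"
proof -
  obtain c where "\<forall>x. p x = (\<Sum>m\<in>mon_idx k. c m * mon m x)"
    using assms unfolding poly_space_iff by blast
  then show ?thesis unfolding poly_space_iff
    by (intro exI[of _ "\<lambda>m. a * c m"]) (simp add: sum_distrib_left algebra_simps)
qed

lemma poly_space_zero: "(\<lambda>x. 0) \<in> poly_space k"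
  unfolding poly_space_iff by (intro exI[of _ "\<lambda>_. 0"]) simp

lemma poly_space_diff:
  assumes "p \<in> poly_space k" "q \<in> poly_space k"
  shows "(\<lambda>x. p x - q x) \<in> poly_space k"
  using poly_space_add[OF assms(1) poly_space_cmult[OF assms(2), of "-1"]] by simp

lemma poly_space_sum:
  assumes "\<And>i. i \<in> A \<Longrightarrow> p i \<in> poly_space k"
  shows "(\<lambda>x. \<Sum>i\<in>A. p i x) \<in> poly_space k"
  using assms
  by (induction A rule: infinite_finite_induct) (auto intro: poly_space_zero poly_space_add)

text \<open>The identity principle in one variable is applied twice: for fixed second coordinate
  \<open>t\<close> the coefficients of the powers of \<open>s\<close> vanish, and each of these is a
  polynomial in \<open>t\<close> that vanishes identically.\<close>

lemma mon_independent:
  assumes "\<And>x. (\<Sum>m\<in>mon_idx k. c m * mon m x) = 0" and m: "m \<in> mon_idx k"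
  shows "c m = 0"
proof -
  have z: "(\<Sum>i\<le>k. (\<Sum>j\<le>k - i. c (i, j) * t ^ j) * s ^ i) = 0" for s t
  proof -
    have "(\<Sum>i\<le>k. (\<Sum>j\<le>k - i. c (i, j) * t ^ j) * s ^ i)
        = (\<Sum>m\<in>mon_idx k. c m * mon m (vector [s, t]))"
      by (simp add: mon_idx_def sum.Sigma mon_def case_prod_beta sum_distrib_left sum_distrib_right vector_2 mult_ac)
    then show ?thesis using assms(1) by simp
  qed
  obtain i j where ij: "m = (i, j)" "i \<le> k" "j \<le> k - i"
    using m by (auto simp: mon_idx_def)
  have "(\<Sum>j\<le>k - i. c (i, j) * t ^ j) = 0" for t
    using z[of t] ij(2) polyfun_eq_0[of "\<lambda>i. \<Sum>j\<le>k - i. c (i, j) * t ^ j" k] by blast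
  then show ?thesis
    using ij polyfun_eq_0[of "\<lambda>j. c (i, j)" "k - i"] by blast
qed

section \<open>Partial derivatives of polynomials and of continuously differentiable
  functions\<close>

lemma partial_deriv_eqI:
  assumes "(p has_derivative p') (at x)"
  shows "partial_deriv i p x = p' (axis i 1)"
  using frechet_derivative_at[OF assms] by (simp add: partial_deriv_def)

lemma axis_components [simp]:
  "axis 1 (1::real) $ (1::2) = 1" "axis 1 (1::real) $ (2::2) = 0"
  "axis 2 (1::real) $ (1::2) = 0" "axis 2 (1::real) $ (2::2) = 1"
  by (auto simp: axis_def)

lemma inner_2: "(x::real^2) \<bullet> y = x $ 1 * y $ 1 + x $ 2 * y $ 2"
  by (simp add: inner_vec_def UNIV_2)

lemma vec_2_expand: "(h::real^2) = h $ 1 *\<^sub>R axis 1 1 + h $ 2 *\<^sub>R axis 2 1"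
  by (simp add: vec_eq_iff forall_2)

lemma has_derivative_partial:
  assumes "p differentiable (at x)"
  shows "(p has_derivative (\<lambda>h. partial_deriv 1 p x * h $ 1 + partial_deriv 2 p x * h $ 2)) (at x)"
proof -
  let ?D = "frechet_derivative p (at x)"
  have D: "(p has_derivative ?D) (at x)" using assms frechet_derivative_works by blast
  then have "linear ?D" by (rule has_derivative_linear)
  have "?D h = partial_deriv 1 p x * h $ 1 + partial_deriv 2 p x * h $ 2" for h
    using \<open>linear ?D\<close>
    by (subst vec_2_expand) (simp add: linear_add linear_scale partial_deriv_def mult.commute)
  then have "?D = (\<lambda>h. partial_deriv 1 p x * h $ 1 + partial_deriv 2 p x * h $ 2)" by blast
  then show ?thesis using D by simp
qed

lemma partial_deriv_add:
  assumes "p differentiable (at x)" "q differentiable (at x)"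
  shows "partial_deriv i (\<lambda>x. p x + q x) x = partial_deriv i p x + partial_deriv i q x"
proof -
  have "((\<lambda>x. p x + q x) has_derivative
      (\<lambda>h. frechet_derivative p (at x) h + frechet_derivative q (at x) h)) (at x)"
    using assms by (intro has_derivative_add) (auto simp: frechet_derivative_works)
  from partial_deriv_eqI[OF this] show ?thesis by (simp add: partial_deriv_def)
qed

lemma partial_deriv_mult:
  assumes "p differentiable (at x)" "q differentiable (at x)"
  shows "partial_deriv i (\<lambda>x. p x * q x) x = p x * partial_deriv i q x + partial_deriv i p x * q x"
proof -
  have "((\<lambda>x. p x * q x) has_derivative
      (\<lambda>h. p x * frechet_derivative q (at x) h + frechet_derivative p (at x) h * q x)) (at x)"
    using assms by (intro has_derivative_mult) (auto simp: frechet_derivative_works)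
  from partial_deriv_eqI[OF this] show ?thesis by (simp add: partial_deriv_def)
qed

lemma partial_deriv_const [simp]: "partial_deriv i (\<lambda>x. c) x = 0"
  using partial_deriv_eqI[of "\<lambda>x. c" "\<lambda>_. 0"] by simp

lemma partial_deriv_cmult:
  assumes "p differentiable (at x)"
  shows "partial_deriv i (\<lambda>x. c * p x) x = c * partial_deriv i p x"
  using partial_deriv_mult[of "\<lambda>_. c" x p i] assms by simp

text \<open>Regularity is required on the whole plane, which avoids one-sided derivatives at the
  boundary of an element. The class is closed under products, so integration by parts will be the
  divergence theorem for a product.\<close>

definition C1 :: "(real^2 \<Rightarrow> real) \<Rightarrow> bool" where
  "C1 g \<longleftrightarrow> (\<forall>x. g differentiable (at x)) \<and> (\<forall>i. continuous_on UNIV (partial_deriv i g))"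

lemma C1_differentiable: "C1 g \<Longrightarrow> g differentiable (at x)"
  by (simp add: C1_def)

lemma C1_continuous_on: "C1 g \<Longrightarrow> continuous_on A g"
  by (simp add: C1_differentiable continuous_at_imp_continuous_on differentiable_imp_continuous_within)

lemma C1_partial_continuous_on: "C1 g \<Longrightarrow> continuous_on A (partial_deriv i g)"
  unfolding C1_def using continuous_on_subset by blast

lemma C1_mult:
  assumes "C1 p" "C1 q"
  shows "C1 (\<lambda>x. p x * q x)"
proof -
  have "partial_deriv i (\<lambda>x. p x * q x) = (\<lambda>x. p x * partial_deriv i q x + partial_deriv i p x * q x)" for i
    using assms by (auto simp: fun_eq_iff partial_deriv_mult C1_differentiable)
  then show ?thesis using assms
    unfolding C1_def using C1_continuous_on[OF assms(1)] C1_continuous_on[OF assms(2)]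
    by (auto intro!: continuous_intros differentiable_mult)
qed

text \<open>For exponent \<open>0\<close> the truncated \<open>fst m - 1\<close> is harmless, since
  the factor \<open>real (fst m)\<close> is then \<open>0\<close>; likewise for the second
  coordinate.\<close>

definition mon_deriv :: "2 \<Rightarrow> nat \<times> nat \<Rightarrow> real^2 \<Rightarrow> real" where
  "mon_deriv i m x = (if i = 1 then real (fst m) * mon (fst m - 1, snd m) x
     else real (snd m) * mon (fst m, snd m - 1) x)"

lemma mon_has_derivative:
  "(mon m has_derivative (\<lambda>h. mon_deriv 1 m x * h $ 1 + mon_deriv 2 m x * h $ 2)) (at x)"
proof -
  have nth: "((\<lambda>x::real^2. x $ i) has_derivative (\<lambda>h. h $ i)) (at x)" for i
    by (rule bounded_linear_imp_has_derivative[OF bounded_linear_vec_nth])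
  have "((\<lambda>x. (x $ 1) ^ fst m * (x $ 2) ^ snd m) has_derivative
     (\<lambda>h. (x $ 1) ^ fst m * (of_nat (snd m) * h $ 2 * (x $ 2) ^ (snd m - 1))
        + (of_nat (fst m) * h $ 1 * (x $ 1) ^ (fst m - 1)) * (x $ 2) ^ snd m)) (at x)"
    by (intro has_derivative_mult has_derivative_power nth)
  then show ?thesis
    by (simp add: mon_def[abs_def] mon_deriv_def algebra_simps)
qed

lemma mon_combination_has_derivative:
  "((\<lambda>x. \<Sum>m\<in>A. c m * mon m x) has_derivative
     (\<lambda>h. \<Sum>m\<in>A. c m * (mon_deriv 1 m x * h $ 1 + mon_deriv 2 m x * h $ 2))) (at x)"
  by (intro has_derivative_sum has_derivative_mult_right mon_has_derivative)

lemma partial_deriv_mon_combination: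
  "partial_deriv i (\<lambda>x. \<Sum>m\<in>A. c m * mon m x) x = (\<Sum>m\<in>A. c m * mon_deriv i m x)"
  using partial_deriv_eqI[OF mon_combination_has_derivative[of c A x], of i] exhaust_2[of i] by auto

lemma partial_deriv_mon: "partial_deriv i (mon m) x = mon_deriv i m x"
  using partial_deriv_mon_combination[of i "\<lambda>_. 1" "{m}" x] by simp

lemma mon_deriv_in_poly_space:
  assumes "m \<in> mon_idx k"
  shows "mon_deriv i m \<in> poly_space (k - 1)"
proof (cases "(if i = 1 then fst m else snd m) = 0")
  case True
  then have "mon_deriv i m = (\<lambda>x. 0)" by (auto simp: mon_deriv_def fun_eq_iff split: if_splits)
  then show ?thesis by (simp add: poly_space_zero)
next
  case False
  then show ?thesis using assms unfolding mon_deriv_def[abs_def] mem_mon_idx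
    by (cases "i = 1") (auto intro!: poly_space_cmult mon_in_poly_space)
qed

lemma poly_space_differentiable:
  assumes "p \<in> poly_space k"
  shows "p differentiable (at x)"
proof -
  obtain c where c: "\<forall>x. p x = (\<Sum>m\<in>mon_idx k. c m * mon m x)"
    using assms unfolding poly_space_iff by blast
  then have "p = (\<lambda>x. \<Sum>m\<in>mon_idx k. c m * mon m x)" by blast
  then show ?thesis
    using mon_combination_has_derivative[of c "mon_idx k" x] unfolding differentiable_def by metis
qed

text \<open>The drop in degree drives the induction in \<open>poly_space_vanishes\<close>. For
  \<open>k = 0\<close> the truncated \<open>k - 1\<close> is \<open>0\<close>, which is still
  correct because the derivative vanishes.\<close>

lemma partial_deriv_in_poly_space_pred:
  assumes "p \<in> poly_space k"
  shows "partial_deriv i p \<in> poly_space (k - 1)"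
proof -
  obtain c where c: "\<forall>x. p x = (\<Sum>m\<in>mon_idx k. c m * mon m x)"
    using assms unfolding poly_space_iff by blast
  then have p: "p = (\<lambda>x. \<Sum>m\<in>mon_idx k. c m * mon m x)" by blast
  have "partial_deriv i p = (\<lambda>x. \<Sum>m\<in>mon_idx k. c m * mon_deriv i m x)"
    unfolding p by (intro ext partial_deriv_mon_combination)
  then show ?thesis
    by (simp only:) (intro poly_space_sum poly_space_cmult mon_deriv_in_poly_space)
qed

lemma poly_space_mono:
  assumes "p \<in> poly_space k" "k \<le> l"
  shows "p \<in> poly_space l"
proof -
  obtain c where c: "\<forall>x. p x = (\<Sum>m\<in>mon_idx k. c m * mon m x)"
    using assms unfolding poly_space_iff by blast
  then have p: "p = (\<lambda>x. \<Sum>m\<in>mon_idx k. c m * mon m x)" by blast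
  show ?thesis unfolding p
    using assms(2) by (intro poly_space_sum poly_space_cmult mon_in_poly_space) (simp add: mem_mon_idx)
qed

lemma partial_deriv_in_poly_space: "p \<in> poly_space k \<Longrightarrow> partial_deriv i p \<in> poly_space k"
  by (rule poly_space_mono[OF partial_deriv_in_poly_space_pred]) auto

lemma constant_of_partial_deriv_zero:
  assumes d: "\<And>x. p differentiable (at x)" and z: "\<And>i x. partial_deriv i p x = 0"
  shows "p x = p y"
proof -
  have "(p has_derivative (\<lambda>h. 0)) (at x within UNIV)" for x
    using has_derivative_partial[OF d, of x] by (simp add: z)
  from has_derivative_zero_constant[OF convex_UNIV this] show ?thesis by auto
qed

lemma poly_space_C1:
  assumes "p \<in> poly_space k"
  shows "C1 p"
proof -
  have "continuous_on UNIV q" if "q \<in> poly_space k" for q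
    using poly_space_differentiable[OF that]
    by (simp add: differentiable_imp_continuous_within continuous_at_imp_continuous_on)
  then show ?thesis
    using assms partial_deriv_in_poly_space poly_space_differentiable unfolding C1_def by blast
qed

lemma partial_deriv_sum_cmult:
  assumes "\<And>m. m \<in> A \<Longrightarrow> q m differentiable (at x)"
  shows "partial_deriv i (\<lambda>x. \<Sum>m\<in>A. c m * q m x) x = (\<Sum>m\<in>A. c m * partial_deriv i (q m) x)"
proof -
  have "((\<lambda>x. \<Sum>m\<in>A. c m * q m x) has_derivative
      (\<lambda>h. \<Sum>m\<in>A. c m * frechet_derivative (q m) (at x) h)) (at x)"
    using assms by (intro has_derivative_sum has_derivative_mult_right) (auto simp: frechet_derivative_works)
  from partial_deriv_eqI[OF this] show ?thesis by (simp add: partial_deriv_def)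
qed

lemma partial_deriv_commute:
  assumes "p \<in> poly_space k"
  shows "partial_deriv i (partial_deriv j p) x = partial_deriv j (partial_deriv i p) x"
proof -
  obtain c where c: "\<forall>x. p x = (\<Sum>m\<in>mon_idx k. c m * mon m x)"
    using assms unfolding poly_space_iff by blast
  then have p: "p = (\<lambda>x. \<Sum>m\<in>mon_idx k. c m * mon m x)" by blast
  have d: "partial_deriv i p = (\<lambda>x. \<Sum>m\<in>mon_idx k. c m * mon_deriv i m x)" for i
    unfolding p by (intro ext partial_deriv_mon_combination)
  have dd: "partial_deriv i (partial_deriv j p) x = (\<Sum>m\<in>mon_idx k. c m * partial_deriv i (mon_deriv j m) x)" for i j
    unfolding d
    by (intro partial_deriv_sum_cmult poly_space_differentiable[OF mon_deriv_in_poly_space])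
  have diff: "mon m differentiable at x" for m
    using mon_has_derivative unfolding differentiable_def by blast
  have "partial_deriv 1 (mon_deriv 2 m) x = partial_deriv 2 (mon_deriv 1 m) x" for m
    unfolding mon_deriv_def[abs_def]
    by (simp add: partial_deriv_cmult diff partial_deriv_mon mon_deriv_def)
  note comm = this
  show ?thesis
    unfolding dd using comm exhaust_2[of i] exhaust_2[of j] by (elim disjE) simp_all
qed

text \<open>Induction on the degree: the partial derivatives vanish on \<open>U\<close> and have
  lower degree, so they vanish everywhere, and the polynomial is a constant whose value can be read
  off in \<open>U\<close>. This passes from an element to the whole plane.\<close>

lemma poly_space_vanishes:
  assumes "p \<in> poly_space k" "open U" "U \<noteq> {}" "\<And>x. x \<in> U \<Longrightarrow> p x = 0"
  shows "p x = 0"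
  using assms(1,4)
proof (induction k arbitrary: p x)
  case 0
  obtain a where a: "a \<in> U" using assms(3) by blast
  have "p x = p a"
    using 0(1) unfolding poly_space_iff by (auto simp: mon_idx_def mon_def)
  then show ?case using 0(2)[OF a] by simp
next
  case (Suc k)
  have d: "partial_deriv i p y = 0" if "y \<in> U" for i y
  proof -
    have "(p has_derivative (\<lambda>h. 0)) (at y)"
      by (rule has_derivative_transform_within_open[OF _ assms(2) that, of "\<lambda>x. 0"])
         (auto simp: Suc.prems(2))
    from partial_deriv_eqI[OF this] show ?thesis by simp
  qed
  have "partial_deriv i p y = 0" for i y
    using Suc.IH[of "partial_deriv i p"] partial_deriv_in_poly_space_pred[OF Suc.prems(1), of i] d by simp
  then have "p x = p y" for y
    by (intro constant_of_partial_deriv_zero poly_space_differentiable[OF Suc.prems(1)])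
  then show ?case using Suc.prems(2) assms(3) by (metis ex_in_conv)
qed

text \<open>Values in an arbitrary Euclidean space allow the triple of unknowns to be one field with
  values in \<open>real \<times> real \<times> (real^2)\<close>, so that trial and test functions
  range over the same space.\<close>

definition poly_fields :: "nat \<Rightarrow> (real^2 \<Rightarrow> 'b::euclidean_space) set" where
  "poly_fields k = {w. \<forall>b\<in>Basis. (\<lambda>x. w x \<bullet> b) \<in> poly_space k}"

lemma poly_fields_iff:
  fixes w :: "real^2 \<Rightarrow> 'b::euclidean_space"
  shows "w \<in> poly_fields k \<longleftrightarrow>
    (\<exists>c. w = (\<lambda>x. \<Sum>(b, m)\<in>Basis \<times> mon_idx k. (c (b, m) * mon m x) *\<^sub>R b))" (is "?L \<longleftrightarrow> ?R")
proof
  assume ?L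
  then have "\<forall>b\<in>Basis. \<exists>c. \<forall>x. w x \<bullet> b = (\<Sum>m\<in>mon_idx k. c m * mon m x)"
    by (simp add: poly_fields_def poly_space_iff)
  then obtain c where c: "\<And>b x. b \<in> Basis \<Longrightarrow> w x \<bullet> b = (\<Sum>m\<in>mon_idx k. c b m * mon m x)"
    by metis
  have "w x = (\<Sum>(b, m)\<in>Basis \<times> mon_idx k. (case_prod c (b, m) * mon m x) *\<^sub>R b)" for x
  proof -
    have "w x = (\<Sum>b\<in>Basis. (w x \<bullet> b) *\<^sub>R b)" by (simp add: euclidean_representation)
    also have "\<dots> = (\<Sum>b\<in>Basis. \<Sum>m\<in>mon_idx k. (c b m * mon m x) *\<^sub>R b)"
      by (intro sum.cong) (auto simp: c scaleR_sum_left)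
    finally show ?thesis by (simp add: sum.cartesian_product)
  qed
  then show ?R by blast
next
  assume ?R
  then obtain c where c: "w = (\<lambda>x. \<Sum>(b, m)\<in>Basis \<times> mon_idx k. (c (b, m) * mon m x) *\<^sub>R b)" by blast
  show ?L
    unfolding poly_fields_def
  proof (intro CollectI ballI)
    fix b :: 'b assume "b \<in> Basis"
    then have "(\<lambda>x. w x \<bullet> b) = (\<lambda>x. \<Sum>(b', m)\<in>Basis \<times> mon_idx k. (b' \<bullet> b) * c (b', m) * mon m x)"
      unfolding c by (auto simp: inner_sum_left case_prod_beta mult_ac intro!: sum.cong)
    then show "(\<lambda>x. w x \<bullet> b) \<in> poly_space k"
      by (auto simp: case_prod_beta mem_mon_idx
          intro!: poly_space_sum poly_space_cmult mon_in_poly_space)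
  qed
qed

lemma poly_fields_add:
  "v \<in> poly_fields k \<Longrightarrow> w \<in> poly_fields k \<Longrightarrow> (\<lambda>x. v x + w x) \<in> poly_fields k"
  by (simp add: poly_fields_def inner_add_left poly_space_add)

lemma poly_fields_scaleR:
  "w \<in> poly_fields k \<Longrightarrow> (\<lambda>x. a *\<^sub>R w x) \<in> poly_fields k"
  by (simp add: poly_fields_def poly_space_cmult)

lemma poly_fields_zero: "(\<lambda>x. 0) \<in> poly_fields k"
  by (simp add: poly_fields_def poly_space_zero)

text \<open>Linearity is restricted to a set of functions because the forms are built from
  integrals, which are additive only on integrable functions.\<close>

definition linear_form_on :: "('a \<Rightarrow> 'b::real_vector) set \<Rightarrow> (('a \<Rightarrow> 'b) \<Rightarrow> real) \<Rightarrow> bool" where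
  "linear_form_on W F \<longleftrightarrow>
     (\<forall>v\<in>W. \<forall>w\<in>W. F (\<lambda>x. v x + w x) = F v + F w) \<and> (\<forall>w\<in>W. \<forall>a. F (\<lambda>x. a *\<^sub>R w x) = a * F w)"

lemma linear_form_on_add:
  "linear_form_on W F \<Longrightarrow> v \<in> W \<Longrightarrow> w \<in> W \<Longrightarrow> F (\<lambda>x. v x + w x) = F v + F w"
  by (simp add: linear_form_on_def)

lemma linear_form_on_scaleR:
  "linear_form_on W F \<Longrightarrow> w \<in> W \<Longrightarrow> F (\<lambda>x. a *\<^sub>R w x) = a * F w"
  by (simp add: linear_form_on_def)

lemma linear_form_on_sum:
  assumes F: "linear_form_on (poly_fields k) F"
    and e: "\<And>i. i \<in> I \<Longrightarrow> e i \<in> poly_fields k"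
  shows "F (\<lambda>x. \<Sum>i\<in>I. c i *\<^sub>R e i x) = (\<Sum>i\<in>I. c i * F (e i))
    \<and> (\<lambda>x. \<Sum>i\<in>I. c i *\<^sub>R e i x) \<in> poly_fields k"
proof -
  have 0: "F (\<lambda>x. 0) = 0"
    using linear_form_on_scaleR[OF F poly_fields_zero, of 0] by simp
  show ?thesis
    using e
  proof (induction I rule: infinite_finite_induct)
    case (insert i I)
    then have i: "e i \<in> poly_fields k" "(\<lambda>x. c i *\<^sub>R e i x) \<in> poly_fields k"
      by (auto intro: poly_fields_scaleR)
    then show ?case
      using insert linear_form_on_add[OF F i(2)] linear_form_on_scaleR[OF F i(1)]
      by (simp add: poly_fields_add)
  qed (simp_all add: 0 poly_fields_zero)
qed

text \<open>With the basis fields \<open>mon m x *\<^sub>R b\<close> for trial and test functions,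
  the variational equation is a square system for the coefficients. The premise \<open>inj\<close>
  speaks of functions; independence of the monomials turns it into a statement on
  coefficients.\<close>

lemma poly_variational_solvable:
  fixes A :: "(real^2 \<Rightarrow> 'b::euclidean_space) \<Rightarrow> (real^2 \<Rightarrow> 'b) \<Rightarrow> real"
  assumes A1: "\<And>v. v \<in> poly_fields k \<Longrightarrow> linear_form_on (poly_fields k) (\<lambda>w. A w v)"
    and A2: "\<And>w. w \<in> poly_fields k \<Longrightarrow> linear_form_on (poly_fields k) (A w)"
    and L: "linear_form_on (poly_fields k) L"
    and inj: "\<And>w. w \<in> poly_fields k \<Longrightarrow> (\<And>v. v \<in> poly_fields k \<Longrightarrow> A w v = 0) \<Longrightarrow> (\<And>x. w x = 0)"
  shows "\<exists>w\<in>poly_fields k. \<forall>v\<in>poly_fields k. A w v = L v"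
proof -
  define I :: "('b \<times> nat \<times> nat) set" where "I = Basis \<times> mon_idx k"
  define e :: "'b \<times> nat \<times> nat \<Rightarrow> real^2 \<Rightarrow> 'b" where "e = (\<lambda>(b, m) x. mon m x *\<^sub>R b)"
  define comb where "comb = (\<lambda>c x. \<Sum>i\<in>I. c i *\<^sub>R e i x)"
  have finI: "finite I" by (simp add: I_def)
  have e: "e i \<in> poly_fields k" if "i \<in> I" for i
    using that unfolding e_def poly_fields_def
    by (auto simp: I_def mem_mon_idx mult.commute[of "mon _ _"] intro!: poly_space_cmult mon_in_poly_space)
  have comb_in: "comb c \<in> poly_fields k" for c
    unfolding comb_def by (rule linear_form_on_sum[OF L e, THEN conjunct2])
  have ex_comb: "\<exists>c. w = comb c" if "w \<in> poly_fields k" for w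
    using that unfolding poly_fields_iff comb_def e_def I_def by (simp add: case_prod_beta)
  have A1': "A (comb c) v = (\<Sum>i\<in>I. c i * A (e i) v)" if "v \<in> poly_fields k" for c v
    unfolding comb_def by (rule linear_form_on_sum[OF A1[OF that] e, THEN conjunct1])
  have A2': "A w (comb c) = (\<Sum>i\<in>I. c i * A w (e i))" if "w \<in> poly_fields k" for c w
    unfolding comb_def by (rule linear_form_on_sum[OF A2[OF that] e, THEN conjunct1])
  have L': "L (comb c) = (\<Sum>i\<in>I. c i * L (e i))" for c
    unfolding comb_def by (rule linear_form_on_sum[OF L e, THEN conjunct1])
  have "\<exists>c. \<forall>i\<in>I. (\<Sum>j\<in>I. A (e j) (e i) * c j) = L (e i)"
  proof (rule square_system[OF finI])
    fix c j
    assume c: "\<And>i. i \<in> I \<Longrightarrow> (\<Sum>j\<in>I. A (e j) (e i) * c j) = 0" and j: "j \<in> I"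
    have "A (comb c) (e i) = 0" if "i \<in> I" for i
      using c[OF that] A1'[OF e[OF that], of c] by (simp add: mult.commute)
    then have "A (comb c) (comb d) = 0" for d
      unfolding A2'[OF comb_in] by (simp add: sum.neutral)
    then have "A (comb c) v = 0" if "v \<in> poly_fields k" for v
      using ex_comb[OF that] by blast
    then have 0: "comb c x = 0" for x
      using inj[OF comb_in] by blast
    obtain b m where bm: "j = (b, m)" "b \<in> Basis" "m \<in> mon_idx k"
      using j by (auto simp: I_def)
    \<comment> \<open>The inner product with \<open>b\<close> isolates the component of the field
      along \<open>b\<close>, because \<open>Basis\<close> is orthonormal.\<close>
    have "(\<Sum>m\<in>mon_idx k. c (b, m) * mon m x) = 0" for x
    proof -
      have "0 = comb c x \<bullet> b" by (simp add: 0)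
      also have "\<dots> = (\<Sum>b'\<in>Basis. \<Sum>m\<in>mon_idx k. c (b', m) * mon m x * (b' \<bullet> b))"
        unfolding comb_def I_def e_def
        by (simp add: inner_sum_left case_prod_beta sum.cartesian_product mult.assoc)
      also have "\<dots> = (\<Sum>b'\<in>Basis. if b' = b then \<Sum>m\<in>mon_idx k. c (b', m) * mon m x else 0)"
        using bm(2) by (intro sum.cong) (auto simp: inner_Basis)
      finally show ?thesis using bm(2) by simp
    qed
    then show "c j = 0" using mon_independent[of "\<lambda>m. c (b, m)" k m] bm by simp
  qed
  then obtain c where c: "\<And>i. i \<in> I \<Longrightarrow> (\<Sum>j\<in>I. A (e j) (e i) * c j) = L (e i)" by blast
  have "A (comb c) (e i) = L (e i)" if "i \<in> I" for i
    using c[OF that] A1'[OF e[OF that], of c] by (simp add: mult.commute)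
  then have "A (comb c) (comb d) = L (comb d)" for d
    unfolding A2'[OF comb_in] L' by (intro sum.cong) simp_all
  then have "A (comb c) v = L v" if "v \<in> poly_fields k" for v
    using ex_comb[OF that] by blast
  then show ?thesis using comb_in by blast
qed


section \<open>Polygons and star-shaped elements\<close>

lemma pathstart_polygonal_path: "ws \<noteq> [] \<Longrightarrow> pathstart (polygonal_path ws) = hd ws"
  by (induction ws rule: polygonal_path.induct) auto

lemma pathfinish_polygonal_path: "ws \<noteq> [] \<Longrightarrow> pathfinish (polygonal_path ws) = last ws"
  by (induction ws rule: polygonal_path.induct) auto

lemma path_image_polygonal_path:
  "length ws \<ge> 2 \<Longrightarrow>
    path_image (polygonal_path ws) = (\<Union>i<length ws - 1. closed_segment (ws ! i) (ws ! Suc i))"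
proof (induction ws rule: polygonal_path.induct)
  case (4 a b c vs)
  have "path_image (polygonal_path (a # b # c # vs))
      = closed_segment a b \<union> path_image (polygonal_path (b # c # vs))"
    by (simp add: path_image_join pathstart_polygonal_path)
  also have "\<dots> = closed_segment a b \<union>
      (\<Union>i<Suc (length vs). closed_segment ((b # c # vs) ! i) ((b # c # vs) ! Suc i))"
    using 4 by simp
  also have "\<dots> = (\<Union>i<Suc (Suc (length vs)).
      closed_segment ((a # b # c # vs) ! i) ((a # b # c # vs) ! Suc i))"
    unfolding lessThan_Suc_eq_insert_0[of "Suc (length vs)"] by (simp add: image_image)
  finally show ?case by simp
qed auto

text \<open>A join of two paths is an arc only if the two parts meet at the joint alone. So the
  first edge touches the remaining path only in \<open>b\<close>, and the rest is induction along
  the path.\<close>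

lemma arc_polygonal_path:
  assumes "arc (polygonal_path ws)" "length ws \<ge> 2"
  shows "(\<forall>i. Suc i < length ws \<longrightarrow> ws ! i \<noteq> ws ! Suc i) \<and>
    (\<forall>i j. i < j \<longrightarrow> Suc j < length ws \<longrightarrow>
      closed_segment (ws ! i) (ws ! Suc i) \<inter> closed_segment (ws ! j) (ws ! Suc j) \<subseteq> {ws ! Suc i})"
  using assms
proof (induction ws rule: polygonal_path.induct)
  case (3 a b)
  then have "a \<noteq> b" using arc_distinct_ends[of "linepath a b"] by auto
  then show ?case by (auto simp: less_Suc_eq)
next
  case (4 a b c vs)
  let ?ws = "b # c # vs"
  have arc: "arc (linepath a b)" "arc (polygonal_path ?ws)"
    "closed_segment a b \<inter> path_image (polygonal_path ?ws) \<subseteq> {b}"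
    using 4(2) by (auto simp: arc_join_eq pathstart_polygonal_path)
  have "a \<noteq> b" using arc_distinct_ends[OF arc(1)] by auto
  have IH: "\<And>i. Suc i < length ?ws \<Longrightarrow> ?ws ! i \<noteq> ?ws ! Suc i"
    "\<And>i j. i < j \<Longrightarrow> Suc j < length ?ws \<Longrightarrow>
      closed_segment (?ws ! i) (?ws ! Suc i) \<inter> closed_segment (?ws ! j) (?ws ! Suc j) \<subseteq> {?ws ! Suc i}"
    using 4(1)[OF arc(2)] by auto
  have first: "closed_segment a b \<inter> closed_segment (?ws ! j) (?ws ! Suc j) \<subseteq> {b}"
    if "Suc j < length ?ws" for j
    using arc(3) that path_image_polygonal_path[of ?ws] by fastforce
  show ?case
  proof (intro conjI allI impI)
    fix i assume "Suc i < length (a # ?ws)"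
    then show "(a # ?ws) ! i \<noteq> (a # ?ws) ! Suc i"
      using IH(1)[of "i - 1"] \<open>a \<noteq> b\<close> by (cases i) auto
  next
    fix i j assume ij: "i < j" "Suc j < length (a # ?ws)"
    then obtain j' where j: "j = Suc j'" by (cases j) auto
    show "closed_segment ((a # ?ws) ! i) ((a # ?ws) ! Suc i)
        \<inter> closed_segment ((a # ?ws) ! j) ((a # ?ws) ! Suc j) \<subseteq> {(a # ?ws) ! Suc i}"
    proof (cases i)
      case 0
      then show ?thesis using first[of j'] ij j by simp
    next
      case (Suc i')
      then show ?thesis using IH(2)[of i' j'] ij j by simp
    qed
  qed
qed auto

text \<open>A closed path is not an arc, but removing the first edge of a simple loop leaves one.
  The first edge meets the rest in both of its ends, since the path returns to its start; hence both
  ends appear in the bound.\<close>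

lemma simple_loop_polygonal_path:
  assumes sp: "simple_path (polygonal_path ws)" and len: "length ws \<ge> 3" and loop: "last ws = hd ws"
  shows "Suc i < length ws \<Longrightarrow> ws ! i \<noteq> ws ! Suc i"
    and "i < j \<Longrightarrow> Suc j < length ws \<Longrightarrow>
      closed_segment (ws ! i) (ws ! Suc i) \<inter> closed_segment (ws ! j) (ws ! Suc j) \<subseteq> {ws ! i, ws ! Suc i}"
proof -
  obtain a b c vs where ws: "ws = a # b # c # vs"
    using len by (metis Suc_le_length_iff numeral_3_eq_3)
  let ?ws = "b # c # vs"
  have arc: "arc (linepath a b)" "arc (polygonal_path ?ws)"
    "closed_segment a b \<inter> path_image (polygonal_path ?ws) \<subseteq> {a, b}"
    using sp loop unfolding ws
    by (auto simp: simple_path_join_loop_eq pathstart_polygonal_path pathfinish_polygonal_path)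
  have "a \<noteq> b" using arc_distinct_ends[OF arc(1)] by auto
  have IH: "\<And>i. Suc i < length ?ws \<Longrightarrow> ?ws ! i \<noteq> ?ws ! Suc i"
    "\<And>i j. i < j \<Longrightarrow> Suc j < length ?ws \<Longrightarrow>
      closed_segment (?ws ! i) (?ws ! Suc i) \<inter> closed_segment (?ws ! j) (?ws ! Suc j) \<subseteq> {?ws ! Suc i}"
    using arc_polygonal_path[OF arc(2)] by auto
  have first: "closed_segment a b \<inter> closed_segment (?ws ! j) (?ws ! Suc j) \<subseteq> {a, b}"
    if "Suc j < length ?ws" for j
    using arc(3) that path_image_polygonal_path[of ?ws] by fastforce
  show "ws ! i \<noteq> ws ! Suc i" if "Suc i < length ws"
    using IH(1)[of "i - 1"] \<open>a \<noteq> b\<close> that unfolding ws by (cases i) auto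
  show "closed_segment (ws ! i) (ws ! Suc i) \<inter> closed_segment (ws ! j) (ws ! Suc j) \<subseteq> {ws ! i, ws ! Suc i}"
    if ij: "i < j" "Suc j < length ws"
  proof -
    obtain j' where j: "j = Suc j'" using ij by (cases j) auto
    show ?thesis
    proof (cases i)
      case 0
      then show ?thesis using first[of j'] ij j unfolding ws by simp
    next
      case (Suc i')
      then show ?thesis using IH(2)[of i' j'] ij j unfolding ws by auto
    qed
  qed
qed

text \<open>The curve is homeomorphic to a circle. By the Jordan-Brouwer theorems it separates the
  plane, so the inside is not empty, and it is the frontier of every component of its
  complement.\<close>

lemma inside_simple_loop:
  fixes \<gamma> :: "real \<Rightarrow> real^2"
  assumes "simple_path \<gamma>" "pathfinish \<gamma> = pathstart \<gamma>"
  shows "inside (path_image \<gamma>) \<noteq> {}"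
    and "connected (inside (path_image \<gamma>)) \<Longrightarrow> frontier (inside (path_image \<gamma>)) = path_image \<gamma>"
proof -
  let ?S = "path_image \<gamma>"
  have "?S homeomorphic sphere (0::complex) 1"
    using homeomorphic_simple_path_image_circle[OF assms] by simp
  also have "sphere (0::complex) 1 homeomorphic sphere (0::real^2) 1"
    by (rule homeomorphic_spheres_gen) auto
  finally have hom: "?S homeomorphic sphere (0::real^2) 1" .
  have bdd: "bounded ?S" by (simp add: assms bounded_simple_path_image)
  show ne: "inside ?S \<noteq> {}"
  proof
    assume "inside ?S = {}"
    then have "outside ?S = - ?S" using inside_Un_outside by blast
    then have "connected (- ?S)" using connected_outside[OF bdd] by simp
    then show False using Jordan_Brouwer_separation[OF hom] by simp
  qed
  assume con: "connected (inside ?S)"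
  obtain x where x: "x \<in> inside ?S" using ne by blast
  have xS: "x \<in> - ?S" using x inside_Un_outside by blast
  \<comment> \<open>The inside is always a union of components of the complement; being connected,
    it is a single one.\<close>
  have "connected_component_set (- ?S) x = inside ?S"
  proof (intro subset_antisym subsetI)
    fix y assume "y \<in> connected_component_set (- ?S) x"
    then show "y \<in> inside ?S" using inside_same_component x by fastforce
  next
    fix y assume "y \<in> inside ?S"
    moreover have "inside ?S \<subseteq> - ?S" using inside_Un_outside by blast
    ultimately show "y \<in> connected_component_set (- ?S) x"
      using con x unfolding connected_component_def by blast
  qed
  then have "inside ?S \<in> components (- ?S)"
    using xS unfolding components_def by blast
  then show "frontier (inside ?S) = ?S"
    by (rule Jordan_Brouwer_frontier[OF hom]) simp
qed

text \<open>Points of the closure, not only of \<open>K\<close>, must move into \<open>K\<close>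
  under every strict contraction towards \<open>c\<close>. For open \<open>K\<close> this implies
  that a ray from \<open>c\<close> meets the frontier at most once.\<close>

definition star_centre :: "(real^2) set \<Rightarrow> real^2 \<Rightarrow> bool" where
  "star_centre K c \<longleftrightarrow> (\<forall>x\<in>closure K. \<forall>s. 0 \<le> s \<and> s < 1 \<longrightarrow> c + s *\<^sub>R (x - c) \<in> K)"

text \<open>A point \<open>x\<close> of the closure is replaced by a nearby \<open>x'\<close> in
  \<open>K\<close>. The error is absorbed by moving the centre slightly, which the surrounding ball
  permits: the contracted point lies on the segment from the displaced centre to
  \<open>x'\<close>.\<close>

lemma star_shaped_wrt_ball_centre:
  assumes "star_shaped_wrt_ball K c r" "c' \<in> ball c r"
  shows "star_centre K c'"
  unfolding star_centre_def
proof (intro ballI allI impI)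
  fix x s assume x: "x \<in> closure K" and s: "0 \<le> s \<and> (s::real) < 1"
  define z where "z = c' + s *\<^sub>R (x - c')"
  \<comment> \<open>\<open>r - dist c c'\<close> is the room left around \<open>c'\<close> in the
    ball; the factor \<open>1 - s\<close> offsets the denominator in \<open>y\<close>.\<close>
  define \<epsilon> where "\<epsilon> = (r - dist c c') * (1 - s)"
  have "\<epsilon> > 0" using assms(2) s by (simp add: \<epsilon>_def)
  then obtain x' where x': "x' \<in> K" "dist x' x < \<epsilon>"
    using x closure_approachable by blast
  \<comment> \<open>The displaced centre, obtained by solving
    \<open>(1 - s) *\<^sub>R y + s *\<^sub>R x' = z\<close> for \<open>y\<close>.\<close>
  define y where "y = c' + (s / (1 - s)) *\<^sub>R (x - x')"
  have "dist c' y = s / (1 - s) * dist x' x"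
    using s by (simp add: y_def dist_norm norm_minus_commute)
  also have "\<dots> \<le> 1 / (1 - s) * dist x' x"
    using s by (intro mult_right_mono divide_right_mono) auto
  also have "\<dots> < 1 / (1 - s) * \<epsilon>"
    using s x' by (intro mult_strict_left_mono) auto
  also have "\<dots> = r - dist c c'"
    using s by (simp add: \<epsilon>_def)
  finally have "y \<in> ball c r"
    using dist_triangle[of c y c'] by simp
  then have "closed_segment y x' \<subseteq> K"
    using assms(1) x'(1) unfolding star_shaped_wrt_ball_def by blast
  moreover have "(1 - s) *\<^sub>R y = (1 - s) *\<^sub>R c' + s *\<^sub>R (x - x')"
    using s by (simp add: y_def scaleR_add_right)
  then have "z = (1 - s) *\<^sub>R y + s *\<^sub>R x'"
    by (simp add: z_def algebra_simps)
  then have "z \<in> closed_segment y x'"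
    using s by (auto simp: closed_segment_def)
  ultimately show "c' + s *\<^sub>R (x - c') \<in> K" by (auto simp: z_def)
qed

text \<open>The determinant of the matrix with columns \<open>x\<close> and
  \<open>y\<close>.\<close>

definition cross :: "real^2 \<Rightarrow> real^2 \<Rightarrow> real" where
  "cross x y = x \<bullet> perp y"

lemma cross_eq: "cross x y = x $ 1 * y $ 2 - x $ 2 * y $ 1"
  by (simp add: cross_def perp_def inner_2 vector_2)

lemma cross_cramer:
  assumes "cross a e \<noteq> 0"
  shows "y = (cross y e / cross a e) *\<^sub>R a + (cross a y / cross a e) *\<^sub>R e"
  using assms unfolding vec_eq_iff forall_2 vector_add_component vector_scaleR_component
  by (simp add: field_simps) (simp add: cross_eq algebra_simps)

lemma cross_combination:
  "cross (s *\<^sub>R a + w *\<^sub>R e) e = s * cross a e"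
  "cross a (s *\<^sub>R a + w *\<^sub>R e) = w * cross a e"
  by (simp_all add: cross_eq algebra_simps)

lemma norm_perp [simp]: "norm (perp v) = norm v"
  by (simp add: norm_eq_sqrt_inner inner_2 perp_def vector_2)

lemma inner_perp_self [simp]: "v \<bullet> perp v = 0"
  by (simp add: inner_2 perp_def vector_2)

lemma continuous_on_cross [continuous_intros]:
  assumes "continuous_on S f" "continuous_on S g"
  shows "continuous_on S (\<lambda>x. cross (f x) (g x))"
  unfolding cross_eq using assms by (intro continuous_intros)

text \<open>Scaling turns agreement of the two half-spaces near \<open>x\<close> into agreement
  everywhere. Testing with two suitable vectors then forces \<open>n \<bullet> m \<ge> 1\<close>,
  the equality case of Cauchy-Schwarz for unit vectors.\<close>

lemma half_plane_normal_unique: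
  fixes n m :: "'a::real_inner"
  assumes n: "norm n = 1" "\<epsilon> > 0" "\<And>y. y \<in> ball x \<epsilon> \<Longrightarrow> P y \<longleftrightarrow> (y - x) \<bullet> n < 0"
    and m: "norm m = 1" "\<delta> > 0" "\<And>y. y \<in> ball x \<delta> \<Longrightarrow> P y \<longleftrightarrow> (y - x) \<bullet> m < 0"
  shows "n = m"
proof -
  have iff: "v \<bullet> n < 0 \<longleftrightarrow> v \<bullet> m < 0" for v
  proof -
    define t where "t = min \<epsilon> \<delta> / (2 * (norm v + 1))"
    have t: "t > 0" using n m by (simp add: t_def add_nonneg_pos)
    have "t * norm v \<le> t * (norm v + 1)" using t by simp
    also have "\<dots> = min \<epsilon> \<delta> / 2"
      by (simp add: t_def field_simps add_nonneg_eq_0_iff)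
    also have "\<dots> < min \<epsilon> \<delta>" using n(2) m(2) by linarith
    finally have "x + t *\<^sub>R v \<in> ball x \<epsilon>" "x + t *\<^sub>R v \<in> ball x \<delta>"
      using t by (auto simp: dist_norm)
    then have "t * (v \<bullet> n) < 0 \<longleftrightarrow> t * (v \<bullet> m) < 0"
      using n(3) m(3) by force
    then show ?thesis using t by (simp add: mult_less_0_iff)
  qed
  have nn: "n \<bullet> n = 1" "m \<bullet> m = 1"
    using n(1) m(1) by (simp_all add: norm_eq_1)
  have pos: "n \<bullet> m > 0"
    using iff[of "- n"] nn by simp
  \<comment> \<open>This vector is orthogonal to \<open>n\<close>, hence outside the open
    half-space; read with \<open>m\<close>, the same fact says that the square of
    \<open>n \<bullet> m\<close> is at least \<open>1\<close>.\<close>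
  have "\<not> ((n \<bullet> m) *\<^sub>R n - m) \<bullet> n < 0"
    by (simp add: inner_diff_left nn inner_commute[of m n])
  then have "\<not> ((n \<bullet> m) *\<^sub>R n - m) \<bullet> m < 0" using iff by blast
  then have "(n \<bullet> m)\<^sup>2 \<ge> 1\<^sup>2"
    by (simp add: inner_diff_left nn power2_eq_square)
  then have "n \<bullet> m \<ge> 1"
    using power2_le_imp_le pos by (metis less_imp_le)
  then have "(n - m) \<bullet> (n - m) \<le> 0"
    by (simp add: inner_diff_left inner_diff_right nn inner_commute[of m n])
  then show ?thesis by (metis inner_ge_zero inner_eq_zero_iff order_antisym right_minus_eq)
qed

text \<open>These are the properties of a polygon from which the integration proceeds: the frontier
  consists of nondegenerate edges whose relative interiors are pairwise disjoint. The orientation of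
  the list is left open.\<close>

locale polygonal_element =
  fixes vs :: "(real^2) list" and K :: "(real^2) set"
  assumes open_K: "open K" and bounded_K: "bounded K" and nonempty_K: "K \<noteq> {}"
    and frontier_K: "frontier K = (\<Union>i<length vs. closed_segment (vs ! i) (vs ! (Suc i mod length vs)))"
    and edge_ends: "i < length vs \<Longrightarrow> vs ! i \<noteq> vs ! (Suc i mod length vs)"
    and edges_disjoint: "i < length vs \<Longrightarrow> j < length vs \<Longrightarrow> i \<noteq> j \<Longrightarrow>
      open_segment (vs ! i) (vs ! (Suc i mod length vs)) \<inter> open_segment (vs ! j) (vs ! (Suc j mod length vs)) = {}"
begin

abbreviation "src i \<equiv> vs ! i"
abbreviation "tgt i \<equiv> vs ! (Suc i mod length vs)"
abbreviation "dir i \<equiv> tgt i - src i"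

lemma edge_eq: "edge vs i t = src i + t *\<^sub>R dir i"
  by (simp add: edge_def linepath_def algebra_simps)

lemma edge_length_eq: "edge_length vs i = norm (dir i)"
  by (simp add: edge_length_def dist_norm norm_minus_commute)

lemma edge_in_frontier: "i < length vs \<Longrightarrow> 0 \<le> t \<Longrightarrow> t \<le> 1 \<Longrightarrow> edge vs i t \<in> frontier K"
  unfolding frontier_K edge_def linepath_def closed_segment_def by auto

lemma frontier_disjoint: "x \<in> frontier K \<Longrightarrow> x \<notin> K"
  using open_K by (simp add: frontier_def interior_open)

lemma frontier_closure: "x \<in> frontier K \<Longrightarrow> x \<in> closure K"
  by (simp add: frontier_def)

text \<open>Twice the signed area of the triangle with vertices \<open>c\<close>,
  \<open>src i\<close> and \<open>tgt i\<close>. It is also the constant factor in the Jacobian of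
  the cone parametrization.\<close>

definition cdet where "cdet c i = cross (src i - c) (dir i)"

lemma centre_frontier:
  assumes "star_centre K c" "x \<in> frontier K" "0 \<le> s" "s < 1"
  shows "c + s *\<^sub>R (x - c) \<notin> frontier K"
  using assms frontier_disjoint frontier_closure unfolding star_centre_def by blast

text \<open>A vanishing determinant puts \<open>c\<close> on the line through the edge. A ray from
  \<open>c\<close> along that line would then contain two frontier points, against
  \<open>centre_frontier\<close>.\<close>

lemma cdet_nonzero:
  assumes c: "star_centre K c" and i: "i < length vs"
  shows "cdet c i \<noteq> 0"
proof
  assume 0: "cdet c i = 0"
  have e: "dir i \<noteq> 0" using edge_ends[OF i] by simp
  have "\<exists>l. c = src i + l *\<^sub>R dir i"
  proof -
    have pp: "dir i \<bullet> dir i \<noteq> 0" using e by simp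
    have "cross (c - src i) (dir i) = 0"
      using 0 by (simp add: cdet_def cross_eq algebra_simps)
    then have "(dir i \<bullet> dir i) *\<^sub>R (c - src i) = ((c - src i) \<bullet> dir i) *\<^sub>R dir i"
      unfolding vec_eq_iff forall_2 vector_scaleR_component inner_2 cross_eq
      by (simp add: algebra_simps) algebra
    from arg_cong[OF this, of "\<lambda>v. (1 / (dir i \<bullet> dir i)) *\<^sub>R v"]
    have "c - src i = (((c - src i) \<bullet> dir i) / (dir i \<bullet> dir i)) *\<^sub>R dir i"
      using pp by simp
    then show ?thesis by (intro exI) (simp only: diff_eq_eq add.commute)
  qed
  then obtain l where l: "c = src i + l *\<^sub>R dir i" by blast
  \<comment> \<open>\<open>l\<close> is the parameter of \<open>c\<close> on the line. The points
    with parameters \<open>t\<close> and \<open>t'\<close> both belong to the edge, and the first is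
    a strict contraction of the second towards \<open>c\<close>.\<close>
  have key: "False" if "0 \<le> t" "t \<le> 1" "0 \<le> t'" "t' \<le> 1" "0 \<le> s" "s < 1" "t - l = s * (t' - l)" for t t' s
  proof -
    have "edge vs i t = c + (t - l) *\<^sub>R dir i" by (simp add: edge_eq l algebra_simps)
    also have "\<dots> = c + s *\<^sub>R (edge vs i t' - c)"
      unfolding that(7) by (simp add: edge_eq l algebra_simps)
    finally show False
      using centre_frontier[OF c edge_in_frontier[OF i that(3,4)] that(5,6)]
        edge_in_frontier[OF i that(1,2)] by simp
  qed
  show False
  \<comment> \<open>Two edge points on the same side of \<open>c\<close> are chosen: for
    \<open>l > 0\<close> both parameters are below \<open>l\<close>, otherwise \<open>1/2\<close>
    and \<open>1\<close> are both above it.\<close>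
  proof (cases "l > 0")
    case True
    show False
      by (rule key[of "min l 1 / 2" 0 "(l - min l 1 / 2) / l"]) (use True in \<open>auto simp: field_simps\<close>)
  next
    case False
    show False
      by (rule key[of "1/2" 1 "(1/2 - l) / (1 - l)"]) (use False in \<open>auto simp: field_simps\<close>)
  qed
qed

text \<open>Every point is \<open>c + ray_s *\<^sub>R (edge vs i t - c)\<close> with \<open>ray_s * t = ray_w\<close> when \<open>ray_s \<noteq> 0\<close>.\<close>

definition "ray_s c i y = cross (y - c) (dir i) / cdet c i"
definition "ray_w c i y = cross (src i - c) (y - c) / cdet c i"

lemma ray_decomposition:
  assumes "cdet c i \<noteq> 0"
  shows "y = c + ray_s c i y *\<^sub>R (src i - c) + ray_w c i y *\<^sub>R dir i"
proof -
  have "y - c = ray_s c i y *\<^sub>R (src i - c) + ray_w c i y *\<^sub>R dir i"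
    unfolding ray_s_def ray_w_def cdet_def
    by (rule cross_cramer) (use assms in \<open>simp add: cdet_def\<close>)
  then show ?thesis by (simp only: diff_eq_eq add_ac)
qed

lemma ray_of_edge:
  assumes "cdet c i \<noteq> 0"
  shows "ray_s c i (c + s *\<^sub>R (edge vs i t - c)) = s" "ray_w c i (c + s *\<^sub>R (edge vs i t - c)) = s * t"
proof -
  have *: "c + s *\<^sub>R (edge vs i t - c) - c = s *\<^sub>R (src i - c) + (s * t) *\<^sub>R dir i"
    by (simp add: edge_eq algebra_simps)
  show "ray_s c i (c + s *\<^sub>R (edge vs i t - c)) = s" "ray_w c i (c + s *\<^sub>R (edge vs i t - c)) = s * t"
    using assms unfolding ray_s_def ray_w_def * by (simp_all add: cross_combination cdet_def)
qed

text \<open>\<open>perp (dir i)\<close> points outward for one orientation of the vertex list and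
  inward for the other. The sign of \<open>cdet c i\<close> corrects this, and dividing by the edge
  length normalizes.\<close>

definition edge_normal :: "real^2 \<Rightarrow> nat \<Rightarrow> real^2" where
  "edge_normal c i = (sgn (cdet c i) / edge_length vs i) *\<^sub>R perp (dir i)"

text \<open>The normal component of \<open>x - c\<close> is constant along an edge: it is the height
  of the triangle with apex \<open>c\<close> over that edge. Height times base is twice the
  area.\<close>

lemma edge_normal_inner:
  assumes "i < length vs"
  shows "edge_length vs i * ((edge vs i t - c) \<bullet> edge_normal c i) = \<bar>cdet c i\<bar>"
proof -
  have "edge_length vs i \<noteq> 0" using edge_ends[OF assms] by (simp add: edge_length_eq)
  moreover have "(edge vs i t - c) \<bullet> perp (dir i) = cdet c i"
  proof -
    have "edge vs i t - c = (src i - c) + t *\<^sub>R dir i" by (simp add: edge_eq)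
    then show ?thesis
      by (simp only: inner_add_left inner_scaleR_left inner_perp_self cdet_def cross_def)
  qed
  ultimately show ?thesis
    unfolding edge_normal_def inner_scaleR_right
    by (simp add: abs_sgn mult.commute)
qed

text \<open>Near a relatively interior point of an edge, \<open>K\<close> is described in ray
  coordinates by \<open>ray_s c i y < 1\<close>, which is a half-plane condition with normal
  \<open>edge_normal c i\<close>. Uniqueness of such a normal identifies the definite
  description.\<close>

lemma outward_normal_edge:
  assumes c: "star_centre K c" and i: "i < length vs" and t: "0 < t" "t < 1"
  shows "outward_normal K (edge vs i t) = edge_normal c i"
proof -
  let ?x = "edge vs i t" and ?n = "edge_normal c i"
  have D: "cdet c i \<noteq> 0" by (rule cdet_nonzero[OF c i])
  have len: "edge_length vs i > 0" using edge_ends[OF i] by (simp add: edge_length_eq)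
  have n1: "norm ?n = 1"
    using len D by (simp add: edge_normal_def edge_length_eq[symmetric] abs_sgn_eq)
  \<comment> \<open>The open infinite cone spanned from \<open>c\<close> by the open edge. Inside
    it, the ray from \<open>c\<close> through a point crosses this edge.\<close>
  define C where "C = {y. 0 < ray_s c i y} \<inter> {y. 0 < ray_w c i y} \<inter> {y. ray_w c i y < ray_s c i y}"
  have "open C"
    unfolding C_def ray_s_def ray_w_def
    by (intro open_Int open_Collect_less continuous_intros) (use D in auto)
  moreover have "?x \<in> C"
    using t ray_of_edge[OF D, of 1 t] by (simp add: C_def)
  ultimately obtain \<epsilon> where \<epsilon>: "\<epsilon> > 0" "ball ?x \<epsilon> \<subseteq> C"
    using open_contains_ball by blast
  have half: "y \<in> K \<longleftrightarrow> (y - ?x) \<bullet> ?n < 0" if "y \<in> ball ?x \<epsilon>" for y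
  proof -
    define s w where "s = ray_s c i y" and "w = ray_w c i y"
    have sw: "0 < s" "0 < w" "w < s" using \<epsilon> that by (auto simp: C_def s_def w_def)
    have y: "y = c + s *\<^sub>R (edge vs i (w / s) - c)"
      using ray_decomposition[OF D, of y] sw(1)
      by (simp add: s_def[symmetric] w_def[symmetric] edge_eq algebra_simps)
    have fr: "edge vs i (w / s) \<in> frontier K"
      using sw by (intro edge_in_frontier[OF i]) auto
    \<comment> \<open>If \<open>y\<close> were in \<open>K\<close> with \<open>s \<ge> 1\<close>,
      contracting it towards \<open>c\<close> by \<open>1 / s\<close> would place the frontier point
      \<open>edge vs i (w / s)\<close> in \<open>K\<close>.\<close>
    have "y \<in> K \<longleftrightarrow> s < 1"
    proof
      assume "s < 1"
      then show "y \<in> K"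
        using c frontier_closure[OF fr] sw unfolding star_centre_def y by auto
    next
      assume "y \<in> K"
      then have *: "c + u *\<^sub>R (y - c) \<in> K" if "0 \<le> u" "u < 1" for u
        using c that closure_subset unfolding star_centre_def by blast
      show "s < 1"
      proof (rule ccontr)
        assume "\<not> s < 1"
        show False
        proof (cases "s = 1")
          case True
          then show False using \<open>y \<in> K\<close> frontier_disjoint[OF fr] by (simp add: y)
        next
          case False
          have "edge vs i (w / s) = c + (1 / s) *\<^sub>R (y - c)"
            using sw by (simp add: y)
          then show False
            using *[of "1 / s"] sw False \<open>\<not> s < 1\<close> frontier_disjoint[OF fr] by simp
        qed
      qed
    qed
    also have "\<dots> \<longleftrightarrow> (y - ?x) \<bullet> ?n < 0"
    proof -
      have "edge_length vs i * ((y - ?x) \<bullet> ?n)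
          = s * (edge_length vs i * ((edge vs i (w / s) - c) \<bullet> ?n)) - edge_length vs i * ((?x - c) \<bullet> ?n)"
        unfolding y by (simp add: algebra_simps inner_add_left inner_diff_left)
      also have "\<dots> = (s - 1) * \<bar>cdet c i\<bar>"
        unfolding edge_normal_inner[OF i] by (simp add: algebra_simps)
      finally have "edge_length vs i * ((y - ?x) \<bullet> ?n) = (s - 1) * \<bar>cdet c i\<bar>" .
      then have "(y - ?x) \<bullet> ?n < 0 \<longleftrightarrow> (s - 1) * \<bar>cdet c i\<bar> < 0"
        using len by (metis mult_less_0_iff not_less_iff_gr_or_eq)
      then show ?thesis using D by (simp add: mult_less_0_iff)
    qed
    finally show ?thesis .
  qed
  show ?thesis
    unfolding outward_normal_def
  proof (rule the_equality)
    show "norm ?n = 1 \<and> (\<exists>\<epsilon>>0. \<forall>y\<in>ball ?x \<epsilon>. (y \<in> K) = ((y - ?x) \<bullet> ?n < 0))"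
      using n1 \<epsilon> half by blast
  next
    fix m assume "norm m = 1 \<and> (\<exists>\<epsilon>>0. \<forall>y\<in>ball ?x \<epsilon>. (y \<in> K) = ((y - ?x) \<bullet> m < 0))"
    then obtain \<delta> where "norm m = 1" "\<delta> > 0" "\<And>y. y \<in> ball ?x \<delta> \<Longrightarrow> (y \<in> K) = ((y - ?x) \<bullet> m < 0)"
      by blast
    then show "m = ?n"
      by (rule half_plane_normal_unique[where P = "\<lambda>y. y \<in> K"]) (use n1 \<epsilon> half in auto)
  qed
qed

text \<open>Polar-like coordinates: the first coordinate is the fraction of the way from
  \<open>c\<close> to the edge, the second the parameter on the edge. Restriction to the open unit
  square excludes the apex, where injectivity fails.\<close>

definition cone_map :: "real^2 \<Rightarrow> nat \<Rightarrow> real^2 \<Rightarrow> real^2" where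
  "cone_map c i x = c + x $ 1 *\<^sub>R (edge vs i (x $ 2) - c)"

definition edge_cone :: "real^2 \<Rightarrow> nat \<Rightarrow> (real^2) set" where
  "edge_cone c i = cone_map c i ` box 0 1"

lemma mem_unit_box: "(x::real^2) \<in> box 0 1 \<longleftrightarrow> 0 < x $ 1 \<and> x $ 1 < 1 \<and> 0 < x $ 2 \<and> x $ 2 < 1"
  by (auto simp: mem_box_cart forall_2)

lemma edge_cone_subset:
  assumes "star_centre K c" "i < length vs"
  shows "edge_cone c i \<subseteq> K"
  using assms edge_in_frontier frontier_closure
  unfolding edge_cone_def cone_map_def star_centre_def
  by (auto simp: mem_unit_box intro!: frontier_closure edge_in_frontier)

lemma cone_map_inj:
  assumes "star_centre K c" "i < length vs"
  shows "inj_on (cone_map c i) (box 0 1)"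
proof (rule inj_onI)
  fix x y :: "real^2"
  assume xy: "x \<in> box 0 1" "y \<in> box 0 1" "cone_map c i x = cone_map c i y"
  then have "x $ 1 = y $ 1" "x $ 1 * x $ 2 = y $ 1 * y $ 2"
    using ray_of_edge[OF cdet_nonzero[OF assms]] unfolding cone_map_def by metis+
  then show "x = y" using xy by (auto simp: vec_eq_iff forall_2 mem_unit_box)
qed

lemma open_segment_edge:
  assumes "i < length vs"
  shows "open_segment (src i) (tgt i) = edge vs i ` {0<..<1}"
  using edge_ends[OF assms] unfolding open_segment_image_interval edge_def linepath_def by auto

text \<open>A common point determines a ray from \<open>c\<close>, which meets the frontier only
  once. The two edge points on it coincide, although the relative interiors of different edges are
  disjoint.\<close>

lemma edge_cones_disjoint:
  assumes c: "star_centre K c" and ij: "i < length vs" "j < length vs" "i \<noteq> j"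
  shows "edge_cone c i \<inter> edge_cone c j = {}"
proof (rule ccontr)
  assume "edge_cone c i \<inter> edge_cone c j \<noteq> {}"
  then obtain x y where xy: "x \<in> box 0 1" "y \<in> box 0 1" "cone_map c i x = cone_map c j y"
    unfolding edge_cone_def by force
  have eq: "x $ 1 *\<^sub>R (edge vs i (x $ 2) - c) = y $ 1 *\<^sub>R (edge vs j (y $ 2) - c)"
    using xy(3) by (simp add: cone_map_def)
  have fr: "edge vs i (x $ 2) \<in> frontier K" "edge vs j (y $ 2) \<in> frontier K"
    using xy ij by (auto intro!: edge_in_frontier simp: mem_unit_box)
  \<comment> \<open>If \<open>a < b\<close>, then \<open>q\<close> would be a strict contraction of
    the frontier point \<open>p\<close> towards \<open>c\<close>.\<close>
  have ratio: "b \<le> a" if "a *\<^sub>R (p - c) = b *\<^sub>R (q - c)" "a > 0" "b > 0"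
    "p \<in> frontier K" "q \<in> frontier K" for a b :: real and p q
  proof (rule ccontr)
    assume "\<not> b \<le> a"
    have "q - c = (a / b) *\<^sub>R (p - c)"
      using arg_cong[OF that(1), of "\<lambda>v. (1 / b) *\<^sub>R v"] that(3) by simp
    then have "q = c + (a / b) *\<^sub>R (p - c)" by (metis add.commute diff_add_cancel)
    then show False
      using centre_frontier[OF c that(4), of "a / b"] that \<open>\<not> b \<le> a\<close> by simp
  qed
  have "x $ 1 = y $ 1"
    using ratio[OF eq _ _ fr] ratio[OF eq[symmetric] _ _ fr(2,1)] xy by (simp add: mem_unit_box)
  then have "edge vs i (x $ 2) = edge vs j (y $ 2)"
    using eq xy by (simp add: mem_unit_box)
  moreover have "edge vs i (x $ 2) \<in> open_segment (src i) (tgt i)"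
    "edge vs j (y $ 2) \<in> open_segment (src j) (tgt j)"
    using xy unfolding open_segment_edge[OF ij(1)] open_segment_edge[OF ij(2)]
    by (auto simp: mem_unit_box)
  ultimately show False using edges_disjoint[OF ij] by auto
qed

text \<open>The ray from \<open>c\<close> through \<open>x\<close> is prolonged to the frontier. It
  ends either inside an edge, and \<open>x\<close> lies in that cone, or at a vertex, and
  \<open>x\<close> lies on one of finitely many segments. The exceptional set is thus
  negligible.\<close>

lemma edge_cones_cover:
  assumes c: "star_centre K c"
  shows "K - (\<Union>i<length vs. edge_cone c i) \<subseteq> (\<Union>i<length vs. closed_segment c (src i) \<union> closed_segment c (tgt i)) \<union> {c}"
proof
  fix x assume x: "x \<in> K - (\<Union>i<length vs. edge_cone c i)"
  show "x \<in> (\<Union>i<length vs. closed_segment c (src i) \<union> closed_segment c (tgt i)) \<union> {c}"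
  proof (cases "x = c")
    case False
    have "x \<in> closure K" using x closure_subset by blast
    then have "c + 0 *\<^sub>R (x - c) \<in> K" using c unfolding star_centre_def by (meson order_refl zero_less_one)
    then have cK: "c \<in> K" by simp
    obtain d where d: "0 < d" "c + d *\<^sub>R (x - c) \<in> frontier K"
      "\<And>e. 0 \<le> e \<Longrightarrow> e < d \<Longrightarrow> c + e *\<^sub>R (x - c) \<in> interior K"
      using ray_to_frontier[OF bounded_K, of c "x - c"] cK False open_K by (auto simp: interior_open)
    have "d > 1"
    proof (rule ccontr)
      assume "\<not> d > 1"
      then consider "d = 1" | "d < 1" by linarith
      then show False
      proof cases
        case 1
        then show False using d frontier_disjoint[OF d(2)] x by simp
      next
        case 2
        then have "c + d *\<^sub>R (x - c) \<in> K"
          using c \<open>x \<in> closure K\<close> d(1) unfolding star_centre_def by simp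
        then show False using frontier_disjoint[OF d(2)] by simp
      qed
    qed
    define y where "y = c + d *\<^sub>R (x - c)"
    have xy: "x = c + (1 / d) *\<^sub>R (y - c)" using d by (simp add: y_def)
    obtain i where i: "i < length vs" "y \<in> closed_segment (src i) (tgt i)"
      using d(2) frontier_K by (auto simp: y_def)
    consider "y = src i \<or> y = tgt i" | "y \<in> open_segment (src i) (tgt i)"
      using i unfolding open_segment_def by blast
    then show ?thesis
    proof cases
      case 1
      have "x \<in> closed_segment c y"
        unfolding closed_segment_def using \<open>d > 1\<close>
        by (intro CollectI exI[of _ "1 / d"]) (simp add: xy algebra_simps)
      then show ?thesis using 1 i by auto
    next
      case 2
      then obtain t where t: "0 < t" "t < 1" "y = edge vs i t"
        unfolding open_segment_edge[OF i(1)] by auto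
      have "x = cone_map c i (vector [1 / d, t])"
        by (simp add: cone_map_def vector_2 xy t)
      moreover have "(vector [1 / d, t] :: real^2) \<in> box 0 1"
        using t \<open>d > 1\<close> by (simp add: mem_unit_box vector_2)
      ultimately have "x \<in> edge_cone c i" unfolding edge_cone_def by blast
      then show ?thesis using x i by blast
    qed
  qed simp
qed

end

lemma polygonal_element_of_mesh:
  assumes mesh: "quasi_uniform_mesh \<Omega> T h \<rho>" and "\<rho> > 0" and "K \<in> T"
    and poly: "polygon_with_vertices vs K"
  shows "polygonal_element vs K" "\<exists>c r. r > 0 \<and> (\<forall>c'\<in>ball c r. star_centre K c')"
proof -
  let ?ws = "vs @ [hd vs]"
  let ?\<gamma> = "polygonal_path ?ws"
  have len: "length vs \<ge> 3" and sp: "simple_path ?\<gamma>" and K: "K = inside (path_image ?\<gamma>)"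
    using poly by (auto simp: polygon_with_vertices_def)
  have ne: "vs \<noteq> []" using len by auto
  have loop: "pathfinish ?\<gamma> = pathstart ?\<gamma>"
    using ne by (simp add: pathstart_polygonal_path pathfinish_polygonal_path)
  have bdd: "bounded (path_image ?\<gamma>)" by (simp add: sp bounded_simple_path_image)
  have Kne: "K \<noteq> {}" unfolding K by (rule inside_simple_loop[OF sp loop])
  have opK: "open K"
    unfolding K by (intro open_inside closed_simple_path_image sp)
  have bK: "bounded K" unfolding K by (rule bounded_inside[OF bdd])
  \<comment> \<open>Positivity of \<open>h\<close> makes \<open>2 * r \<ge> \<rho> * h\<close> yield
    a ball of positive radius. It comes from a small ball inside the nonempty open set
    \<open>K\<close>.\<close>
  have "h > 0"
  proof -
    obtain x where "x \<in> K" using Kne by blast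
    then obtain e where e: "e > 0" "cball x e \<subseteq> K" using opK open_contains_cball by blast
    have "diameter (cball x e) \<le> diameter K" by (rule diameter_subset[OF e(2) bK])
    then have "diameter K > 0" using e(1) by simp
    moreover have "diameter K \<le> h"
      using mesh \<open>K \<in> T\<close> unfolding quasi_uniform_mesh_def by auto
    ultimately show ?thesis by simp
  qed
  obtain c r where cr: "2 * r \<ge> \<rho> * h" "star_shaped_wrt_ball K c r"
    using mesh \<open>K \<in> T\<close> unfolding quasi_uniform_mesh_def by blast
  have r: "r > 0" using cr(1) \<open>h > 0\<close> \<open>\<rho> > 0\<close> mult_pos_pos[of \<rho> h] by linarith
  have centre: "star_centre K c'" if "c' \<in> ball c r" for c'
    using star_shaped_wrt_ball_centre[OF cr(2) that] .
  then show "\<exists>c r. r > 0 \<and> (\<forall>c'\<in>ball c r. star_centre K c')" using r by blast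
  \<comment> \<open>Star-shapedness supplies connectedness of the inside, under which the frontier
    of \<open>K\<close> is the whole polygonal curve.\<close>
  have "starlike K"
    using cr(2) r unfolding starlike_def star_shaped_wrt_ball_def
    by (metis centre_in_ball subsetD)
  then have "connected K" by (rule starlike_imp_connected)
  then have fr: "frontier K = path_image ?\<gamma>"
    using inside_simple_loop(2)[OF sp loop] K by simp
  \<comment> \<open>The closing edge ends at the appended copy of the first vertex, which is the
    vertex that the index modulo \<open>length vs\<close> wraps to.\<close>
  have ws: "?ws ! i = vs ! i" "?ws ! Suc i = vs ! (Suc i mod length vs)" if "i < length vs" for i
    using that ne by (auto simp: nth_append hd_conv_nth mod_Suc)
  have ends: "last ?ws = hd ?ws" using ne by simp
  have len': "length ?ws \<ge> 3" using len by simp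
  show "polygonal_element vs K"
  proof
    show "open K" "bounded K" "K \<noteq> {}" by fact+
    have "path_image ?\<gamma> = (\<Union>i<length vs. closed_segment (?ws ! i) (?ws ! Suc i))"
      using path_image_polygonal_path[of ?ws] len by simp
    also have "\<dots> = (\<Union>i<length vs. closed_segment (vs ! i) (vs ! (Suc i mod length vs)))"
      by (intro SUP_cong refl) (simp only: ws lessThan_iff)
    finally show "frontier K = (\<Union>i<length vs. closed_segment (vs ! i) (vs ! (Suc i mod length vs)))"
      using fr by simp
  next
    fix i assume "i < length vs"
    then show "vs ! i \<noteq> vs ! (Suc i mod length vs)"
      using simple_loop_polygonal_path(1)[OF sp len' ends, of i] ws[of i] by simp
  next
    fix i j assume ij: "i < length vs" "j < length vs" "i \<noteq> j"
    have *: "open_segment (vs ! i) (vs ! (Suc i mod length vs)) \<inter> closed_segment (vs ! j) (vs ! (Suc j mod length vs)) = {}"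
      if "i < j" "j < length vs" for i j
      using simple_loop_polygonal_path(2)[OF sp len' ends, of i j] ws[of i] ws[of j] that
      unfolding open_segment_def by auto
    show "open_segment (vs ! i) (vs ! (Suc i mod length vs)) \<inter> open_segment (vs ! j) (vs ! (Suc j mod length vs)) = {}"
    proof (cases "i < j")
      case True
      then show ?thesis using *[of i j] ij unfolding open_segment_def by blast
    next
      case False
      then show ?thesis using *[of j i] ij unfolding open_segment_def by auto
    qed
  qed
qed


section \<open>The divergence theorem\<close>

lemma vector_2_measurable [measurable]:
  "(\<lambda>p. vector [fst p, snd p] :: real^2) \<in> borel_measurable (borel :: (real \<times> real) measure)"
proof -
  have "(\<lambda>p. vector [fst p, snd p] :: real^2) = (\<lambda>p. fst p *\<^sub>R axis 1 1 + snd p *\<^sub>R axis 2 1)"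
    by (subst vec_2_expand) (simp add: vector_2)
  then show ?thesis
    by (simp only:) (intro borel_measurable_continuous_onI continuous_intros)
qed

lemma Basis_real2: "(Basis :: (real^2) set) = {axis 1 1, axis 2 1}"
  unfolding Basis_vec_def by (auto simp: exhaust_2) (metis exhaust_2)

lemma axis_1_2_neq: "axis 1 (1::real) \<noteq> (axis 2 1 :: real^2)"
  by (simp add: axis_eq_axis)

text \<open>Both measures assign to a box the product of its side lengths, which determines Lebesgue
  measure. Integrals over the vector type can thus be treated as integrals over pairs.\<close>

lemma lborel_real2:
  "(lborel :: (real^2) measure) = distr (lborel :: (real \<times> real) measure) borel (\<lambda>p. vector [fst p, snd p])"
proof (rule lborel_eqI)
  fix l u :: "real^2"
  assume lu: "\<And>b. b \<in> Basis \<Longrightarrow> l \<bullet> b \<le> u \<bullet> b"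
  have le: "l $ 1 \<le> u $ 1" "l $ 2 \<le> u $ 2"
    using lu[of "axis 1 1"] lu[of "axis 2 1"] by (simp_all add: Basis_real2 inner_axis)
  have pre: "(\<lambda>p. vector [fst p, snd p]) -` box l u \<inter> space lborel = box (l $ 1, l $ 2) (u $ 1, u $ 2)"
    by (auto simp: mem_box_cart forall_2 vector_2 mem_box Basis_prod_def)
  have "emeasure (distr lborel borel (\<lambda>p. vector [fst p, snd p] :: real^2)) (box l u)
      = emeasure lborel (box (l $ 1, l $ 2) (u $ 1, u $ 2))"
    using pre by (subst emeasure_distr) simp_all
  also have "\<dots> = (u $ 1 - l $ 1) * (u $ 2 - l $ 2)"
    using le by (subst emeasure_lborel_box) (auto simp: Basis_prod_def)
  also have "\<dots> = (\<Prod>b\<in>Basis. (u - l) \<bullet> b)"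
    by (simp add: Basis_real2 axis_1_2_neq inner_axis)
  finally show "emeasure (distr lborel borel (\<lambda>p. vector [fst p, snd p] :: real^2)) (box l u)
      = (\<Prod>b\<in>Basis. (u - l) \<bullet> b)" .
qed simp

lemma integral_unit_box:
  fixes h :: "real^2 \<Rightarrow> real"
  assumes h: "continuous_on UNIV h"
  shows "integral (box 0 1) h = integral {0..1} (\<lambda>t. integral {0..1} (\<lambda>s. h (vector [s, t])))"
proof -
  let ?v = "\<lambda>p. vector [fst p, snd p] :: real^2"
  have hm [measurable]: "h \<in> borel_measurable borel"
    using h by (rule borel_measurable_continuous_onI)
  have cv: "continuous_on UNIV ?v"
  proof -
    have "?v = (\<lambda>p. fst p *\<^sub>R axis 1 1 + snd p *\<^sub>R axis 2 1)"
      by (subst vec_2_expand) (simp add: vector_2)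
    then show ?thesis by (simp only:) (intro continuous_intros)
  qed
  have chv: "continuous_on UNIV (\<lambda>p. h (?v p))"
    by (rule continuous_on_compose2[OF h cv]) auto
  have ind: "indicator (cbox 0 1) (?v p) = (indicator (cbox (0, 0) (1, 1)) p :: real)" for p
    by (cases p) (auto simp: indicator_def mem_box_cart forall_2 vector_2 cbox_Pair_eq split: if_splits)
  have si: "set_integrable lborel (cbox 0 1) h"
    "set_integrable lborel (cbox (0, 0) (1, 1)) (\<lambda>p. h (?v p))"
    unfolding set_integrable_def
    by (intro borel_integrable_compact compact_cbox continuous_on_subset[OF h subset_UNIV]
        continuous_on_subset[OF chv subset_UNIV])+
  have "integral (box 0 1) h = integral (cbox 0 1) h"
    by (rule integral_open_interval)
  also have "\<dots> = (LINT x:cbox 0 1|lborel. h x)"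
    by (rule set_borel_integral_eq_integral(2)[symmetric, OF si(1)])
  also have "\<dots> = integral\<^sup>L lborel (\<lambda>p. indicator (cbox 0 1) (?v p) *\<^sub>R h (?v p))"
    unfolding set_lebesgue_integral_def
    by (subst lborel_real2, subst integral_distr) simp_all
  also have "\<dots> = (LINT p:cbox (0, 0) (1, 1)|lborel. h (?v p))"
    unfolding set_lebesgue_integral_def by (simp only: ind)
  also have "\<dots> = integral (cbox (0, 0) (1, 1)) (\<lambda>p. h (?v p))"
    by (rule set_borel_integral_eq_integral(2)[OF si(2)])
  also have "\<dots> = integral (cbox 0 1) (\<lambda>s. integral (cbox 0 1) (\<lambda>t. h (vector [s, t])))"
    using integral_prod_continuous[OF continuous_on_subset[OF chv subset_UNIV], of 0 0 1 1] by simp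
  \<comment> \<open>The order is exchanged so that the first coordinate, the radial one in the
    application, is integrated first.\<close>
  also have "\<dots> = integral (cbox 0 1) (\<lambda>t. integral (cbox 0 1) (\<lambda>s. h (vector [s, t])))"
    by (rule integral_swap_continuous)
       (simp add: case_prod_beta continuous_on_subset[OF chv])
  finally show ?thesis by simp
qed

lemma negligible_closed_segment_real2: "negligible (closed_segment a (b::real^2))"
  by (simp add: negligible_convex_interior interior_closed_segment_ge2)

text \<open>Integrands with the outward normal are known only between the corners of an edge.
  Measurability, integrability and the integral survive arbitrary values at the two ends.\<close>

lemma lebesgue_on_01_spike:
  fixes f g :: "real \<Rightarrow> 'b::euclidean_space"
  assumes eq: "\<And>t. 0 < t \<Longrightarrow> t < 1 \<Longrightarrow> f t = g t"
    and g: "g \<in> borel_measurable (lebesgue_on {0..1})"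
  shows "f \<in> borel_measurable (lebesgue_on {0..1})"
    and "integral\<^sup>L (lebesgue_on {0..1}) f = integral\<^sup>L (lebesgue_on {0..1}) g"
    and "integrable (lebesgue_on {0..1}) g \<Longrightarrow> integrable (lebesgue_on {0..1}) f"
proof -
  have S: "{t \<in> space (lebesgue_on {0..1}). t = a} \<in> sets (lebesgue_on {0..1})" for a :: real
  proof -
    have "{t \<in> space (lebesgue_on {0..1}). t = a} = {0..1} \<inter> {a}" by auto
    then show ?thesis by (simp add: sets_restrict_space)
  qed
  have "(\<lambda>t. if t = 0 then f 0 else if t = 1 then f 1 else g t) \<in> borel_measurable (lebesgue_on {0..1})"
    by (intro measurable_If measurable_const g S) simp_all
  then show f: "f \<in> borel_measurable (lebesgue_on {0..1})"
    by (rule measurable_cong[THEN iffD1, rotated]) (use eq in \<open>auto simp: less_le\<close>)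
  have AE: "AE t in lebesgue_on {0..1}. f t = g t"
  proof (rule AE_I')
    show "{0, 1} \<in> null_sets (lebesgue_on {0..1::real})"
      by (auto simp: null_sets_def emeasure_restrict_space sets_restrict_space_iff emeasure_lborel_countable)
    show "{t \<in> space (lebesgue_on {0..1}). f t \<noteq> g t} \<subseteq> {0, 1}"
      using eq by (auto simp: less_le)
  qed
  then show "integral\<^sup>L (lebesgue_on {0..1}) f = integral\<^sup>L (lebesgue_on {0..1}) g"
    by (intro integral_cong_AE f g)
  show "integrable (lebesgue_on {0..1}) g \<Longrightarrow> integrable (lebesgue_on {0..1}) f"
    by (rule Bochner_Integration.integrable_cong_AE_imp[OF _ f]) (use AE in auto)
qed

text \<open>The divergence of \<open>x \<mapsto> g x *\<^sub>R (x - c)\<close>.\<close>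

definition radial_div :: "real^2 \<Rightarrow> (real^2 \<Rightarrow> real) \<Rightarrow> real^2 \<Rightarrow> real" where
  "radial_div c g x = 2 * g x + (partial_deriv 1 g x * (x - c) $ 1 + partial_deriv 2 g x * (x - c) $ 2)"

lemma radial_div_continuous: "C1 g \<Longrightarrow> continuous_on A (radial_div c g)"
  unfolding radial_div_def[abs_def]
  by (intro continuous_intros C1_continuous_on C1_partial_continuous_on)

text \<open>The integrand is the derivative of \<open>s\<^sup>2 * g (c + s *\<^sub>R v)\<close>. The
  factor \<open>s\<close> is the radial part of the Jacobian of \<open>cone_map\<close>, and the
  square makes the lower limit contribute nothing.\<close>

lemma radial_integral:
  assumes g: "C1 g"
  shows "integral {0..1} (\<lambda>s. s * radial_div c g (c + s *\<^sub>R v)) = g (c + v)"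
proof -
  have "((\<lambda>s. s * radial_div c g (c + s *\<^sub>R v)) has_integral
      1\<^sup>2 * g (c + 1 *\<^sub>R v) - 0\<^sup>2 * g (c + 0 *\<^sub>R v)) {0..1}"
  proof (rule fundamental_theorem_of_calculus)
    fix s :: real assume "s \<in> {0..1}"
    let ?x = "c + s *\<^sub>R v"
    let ?G = "partial_deriv 1 g ?x * v $ 1 + partial_deriv 2 g ?x * v $ 2"
    have "((\<lambda>s. g (c + s *\<^sub>R v)) has_derivative
        (\<lambda>h. partial_deriv 1 g ?x * (h *\<^sub>R v) $ 1 + partial_deriv 2 g ?x * (h *\<^sub>R v) $ 2)) (at s)"
      by (rule has_derivative_compose[of "\<lambda>s. c + s *\<^sub>R v" _ s UNIV g])
         (auto intro!: derivative_eq_intros has_derivative_partial C1_differentiable g)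
    then have d: "((\<lambda>s. g (c + s *\<^sub>R v)) has_real_derivative ?G) (at s)"
      by (rule has_derivative_imp_has_field_derivative) (simp add: algebra_simps)
    have "((\<lambda>s. s\<^sup>2 * g (c + s *\<^sub>R v)) has_real_derivative
        (2 * s * g ?x + s\<^sup>2 * ?G)) (at s)"
      by (auto intro!: derivative_eq_intros d)
    moreover have "2 * s * g ?x + s\<^sup>2 * ?G = s * radial_div c g ?x"
      by (simp add: radial_div_def power2_eq_square algebra_simps)
    ultimately have "((\<lambda>s. s\<^sup>2 * g (c + s *\<^sub>R v)) has_real_derivative (s * radial_div c g ?x)) (at s)"
      by simp
    then show "((\<lambda>s. s\<^sup>2 * g (c + s *\<^sub>R v)) has_vector_derivative s * radial_div c g ?x) (at s within {0..1})"
      by (simp add: has_real_derivative_iff_has_vector_derivative has_vector_derivative_at_within)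
  qed simp
  then show ?thesis by (auto dest: integral_unique)
qed

context polygonal_element
begin

section \<open>Integration over the cones and over the element\<close>

lemma cone_map_has_derivative:
  "(cone_map c i has_derivative
     (\<lambda>h. h $ 1 *\<^sub>R (edge vs i (x $ 2) - c) + (x $ 1 * h $ 2) *\<^sub>R dir i)) (at x within S)"
proof -
  have nth: "((\<lambda>x::real^2. x $ j) has_derivative (\<lambda>h. h $ j)) (at x within S)" for j
    by (rule bounded_linear_imp_has_derivative[OF bounded_linear_vec_nth])
  show ?thesis
    unfolding cone_map_def[abs_def] edge_eq
    by (auto intro!: derivative_eq_intros nth simp: algebra_simps)
qed

lemma det_cone_map_derivative:
  "det (matrix (\<lambda>h. h $ 1 *\<^sub>R (edge vs i t - c) + (s * h $ 2) *\<^sub>R dir i)) = s * cdet c i"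
  by (simp add: det_2 matrix_def edge_eq cdet_def cross_eq algebra_simps)

lemma cone_map_continuous: "continuous_on A (cone_map c i)"
  by (rule has_derivative_continuous_on[OF cone_map_has_derivative])

text \<open>The change of variables by \<open>cone_map\<close> has Jacobian
  \<open>\<bar>s * cdet c i\<bar>\<close>. The inner integral is then the one of
  \<open>radial_integral\<close>, and only values of \<open>g\<close> on the edge remain.\<close>

lemma edge_cone_integral:
  assumes c: "star_centre K c" and i: "i < length vs" and g: "C1 g"
  shows "(radial_div c g has_integral \<bar>cdet c i\<bar> * integral {0..1} (\<lambda>t. g (edge vs i t))) (edge_cone c i)"
proof -
  \<comment> \<open>\<open>has_absolute_integral_change_of_variables\<close> integrates functions
    with values in Cartesian spaces; the scalar integrand enters through
    \<open>real^1\<close>.\<close>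
  let ?q = "\<lambda>x. vec (radial_div c g x) :: real^1"
  let ?g' = "\<lambda>x h. h $ 1 *\<^sub>R (edge vs i (x $ 2) - c) + (x $ 1 * h $ 2) *\<^sub>R dir i"
  define H where "H = (\<lambda>x::real^2. \<bar>x $ 1 * cdet c i\<bar> * radial_div c g (cone_map c i x))"
  have H: "continuous_on UNIV H"
    unfolding H_def
    by (intro continuous_intros continuous_on_compose2[OF radial_div_continuous[OF g] cone_map_continuous]) auto
  have Habs: "H absolutely_integrable_on box 0 1"
    using absolutely_integrable_continuous[OF continuous_on_subset[OF H], of 0 1]
    by (metis box_subset_cbox set_integrable_subset lmeasurable_box fmeasurableD subset_UNIV)
  have "integral (box 0 1) H = integral {0..1} (\<lambda>t. integral {0..1} (\<lambda>s. H (vector [s, t])))"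
    by (rule integral_unit_box[OF H])
  also have "\<dots> = integral {0..1} (\<lambda>t. \<bar>cdet c i\<bar> * g (edge vs i t))"
  proof (rule integral_cong)
    fix t :: real
    have "integral {0..1} (\<lambda>s. H (vector [s, t]))
        = integral {0..1} (\<lambda>s. \<bar>cdet c i\<bar> * (s * radial_div c g (c + s *\<^sub>R (edge vs i t - c))))"
      by (rule integral_cong) (simp add: H_def vector_2 cone_map_def abs_mult)
    then show "integral {0..1} (\<lambda>s. H (vector [s, t])) = \<bar>cdet c i\<bar> * g (edge vs i t)"
      by (simp add: radial_integral[OF g])
  qed
  finally have intH: "integral (box 0 1) H = \<bar>cdet c i\<bar> * integral {0..1} (\<lambda>t. g (edge vs i t))"
    by simp
  have eq: "\<bar>det (matrix (?g' x))\<bar> *\<^sub>R ?q (cone_map c i x) = vec (H x)" for x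
    unfolding det_cone_map_derivative by (simp add: H_def vec_eq_iff)
  have "(\<lambda>x. \<bar>det (matrix (?g' x))\<bar> *\<^sub>R ?q (cone_map c i x)) absolutely_integrable_on box 0 1 \<and>
      integral (box 0 1) (\<lambda>x. \<bar>det (matrix (?g' x))\<bar> *\<^sub>R ?q (cone_map c i x))
        = vec (\<bar>cdet c i\<bar> * integral {0..1} (\<lambda>t. g (edge vs i t)))"
    unfolding eq using Habs intH
    by (simp add: absolutely_integrable_on_1_iff integral_on_1_eq)
  then have "?q absolutely_integrable_on cone_map c i ` box 0 1 \<and>
      integral (cone_map c i ` box 0 1) ?q = vec (\<bar>cdet c i\<bar> * integral {0..1} (\<lambda>t. g (edge vs i t)))"
    by (subst (asm) has_absolute_integral_change_of_variables[OF _ cone_map_has_derivative cone_map_inj[OF c i]])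
       auto
  then show ?thesis
    unfolding edge_cone_def
    by (auto simp: absolutely_integrable_on_1_iff integral_on_1_eq vec_eq_iff has_integral_iff
        absolutely_integrable_on_def)
qed

lemma radial_divergence_theorem:
  assumes c: "star_centre K c" and g: "C1 g"
  shows "(radial_div c g has_integral
    (\<Sum>i<length vs. \<bar>cdet c i\<bar> * integral {0..1} (\<lambda>t. g (edge vs i t)))) K"
proof -
  let ?U = "\<Union>i<length vs. edge_cone c i"
  have "(radial_div c g has_integral
      (\<Sum>i<length vs. \<bar>cdet c i\<bar> * integral {0..1} (\<lambda>t. g (edge vs i t)))) ?U"
    by (rule has_integral_UN)
       (auto intro!: edge_cone_integral c g simp: pairwise_def edge_cones_disjoint[OF c])
  moreover have "?U \<subseteq> K" using edge_cone_subset[OF c] by blast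
  moreover have "negligible (K - ?U)"
    by (rule negligible_subset[OF _ edge_cones_cover[OF c]])
       (auto simp: negligible_closed_segment_real2)
  ultimately show ?thesis
    by (subst has_integral_spike_set_eq[of K ?U]) (auto intro: negligible_subset)
qed

lemma K_lebesgue [simp]: "K \<in> sets lebesgue"
  using open_K by simp

lemma continuous_integrable_K:
  fixes g :: "real^2 \<Rightarrow> 'b::euclidean_space"
  assumes "continuous_on UNIV g"
  shows "integrable (lebesgue_on K) g"
proof -
  obtain a where a: "K \<subseteq> cbox (- a) a"
    using bounded_subset_cbox_symmetric[OF bounded_K] .
  have "set_integrable lebesgue (cbox (- a) a) g"
    by (rule absolutely_integrable_continuous) (rule continuous_on_subset[OF assms subset_UNIV])
  then have "set_integrable lebesgue K g"
    by (rule set_integrable_subset) (simp_all add: a)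
  then show ?thesis
    by (simp add: integrable_restrict_space set_integrable_def)
qed

lemma edge_continuous: "continuous_on A (edge vs i)"
  unfolding edge_eq[abs_def] by (intro continuous_intros)

text \<open>\<open>F\<close> stands for an expression in the normal. It may jump from edge to edge,
  so it gets a separate continuous representative \<open>G i\<close> on each open edge.\<close>

lemma boundary_inner_continuous:
  assumes c: "star_centre K c" and g: "continuous_on UNIV g"
    and F: "\<And>i t. i < length vs \<Longrightarrow> 0 < t \<Longrightarrow> t < 1 \<Longrightarrow> F (edge vs i t) = G i (edge vs i t)"
    and G: "\<And>i. i < length vs \<Longrightarrow> continuous_on UNIV (G i)"
  shows "L2_boundary_inner vs g F
    = (\<Sum>i<length vs. edge_length vs i * integral {0..1} (\<lambda>t. g (edge vs i t) * G i (edge vs i t)))"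
  unfolding L2_boundary_inner_def
proof (rule sum.cong[OF refl])
  fix i assume "i \<in> {..<length vs}"
  then have i: "i < length vs" by simp
  let ?h = "\<lambda>t. g (edge vs i t) * G i (edge vs i t)"
  have cont: "continuous_on {0..1} ?h"
    by (intro continuous_intros continuous_on_compose2[OF g edge_continuous]
        continuous_on_compose2[OF G[OF i] edge_continuous]) auto
  have int: "integrable (lebesgue_on {0..1}) ?h"
    using continuous_imp_integrable_real[OF cont] .
  have "integral\<^sup>L (lebesgue_on {0..1}) (\<lambda>t. g (edge vs i t) * F (edge vs i t))
      = integral\<^sup>L (lebesgue_on {0..1}) ?h"
    using F[OF i] int by (intro lebesgue_on_01_spike(2)) auto
  also have "\<dots> = integral {0..1} ?h"
    by (rule lebesgue_integral_eq_integral[OF int]) simp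
  finally show "edge_length vs i * integral\<^sup>L (lebesgue_on {0..1}) (\<lambda>t. g (edge vs i t) * F (edge vs i t))
      = edge_length vs i * integral {0..1} ?h" by simp
qed

end

locale star_element = polygonal_element +
  fixes c0 :: "real^2" and r0 :: real
  assumes r0: "r0 > 0" and centres: "c \<in> ball c0 r0 \<Longrightarrow> star_centre K c"
begin

lemma centre0: "star_centre K c0"
  using centres r0 by simp

definition nrm :: "nat \<Rightarrow> real^2" where "nrm i = edge_normal c0 i"

lemma outward_normal_nrm:
  "i < length vs \<Longrightarrow> 0 < t \<Longrightarrow> t < 1 \<Longrightarrow> outward_normal K (edge vs i t) = nrm i"
  unfolding nrm_def using outward_normal_edge centre0 by blast

text \<open>Both sides equal the outward normal at the midpoint of the edge, which is defined
  without reference to a centre.\<close>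

lemma edge_normal_centre:
  assumes "star_centre K c" "i < length vs"
  shows "edge_normal c i = nrm i"
  using outward_normal_edge[OF assms, of "1/2"] outward_normal_nrm[OF assms(2), of "1/2"] by simp

lemma norm_nrm: "i < length vs \<Longrightarrow> norm (nrm i) = 1"
  using edge_ends[of i] cdet_nonzero[OF centre0, of i]
  by (simp add: nrm_def edge_normal_def edge_length_eq[symmetric] abs_sgn_eq) (simp add: edge_length_eq)

text \<open>The radial theorem for two centres; only the difference of the centres survives.\<close>

lemma divergence_theorem_direction:
  assumes g: "C1 g" and d: "norm d < r0"
  shows "((\<lambda>x. partial_deriv 1 g x * d $ 1 + partial_deriv 2 g x * d $ 2) has_integral
    (\<Sum>i<length vs. edge_length vs i * ((d \<bullet> nrm i) * integral {0..1} (\<lambda>t. g (edge vs i t))))) K"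
proof -
  let ?I = "\<lambda>i. integral {0..1} (\<lambda>t. g (edge vs i t))"
  have c1: "star_centre K (c0 - d)" using d by (intro centres) (simp add: dist_norm)
  \<comment> \<open>The absolute value becomes linear in the centre because the same normal serves
    both centres. Any point of the edge could be inserted; the start point is taken.\<close>
  have abs_diff: "\<bar>cdet (c0 - d) i\<bar> - \<bar>cdet c0 i\<bar> = edge_length vs i * (d \<bullet> nrm i)" if i: "i < length vs" for i
  proof -
    have "\<bar>cdet (c0 - d) i\<bar> - \<bar>cdet c0 i\<bar> =
        edge_length vs i * ((edge vs i 0 - (c0 - d)) \<bullet> nrm i) - edge_length vs i * ((edge vs i 0 - c0) \<bullet> nrm i)"
      using edge_normal_inner[OF i, of 0 c0] edge_normal_inner[OF i, of 0 "c0 - d"]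
      by (simp add: edge_normal_centre[OF c1 i] nrm_def)
    also have "\<dots> = edge_length vs i * (d \<bullet> nrm i)"
      by (simp add: inner_diff_left algebra_simps)
    finally show ?thesis .
  qed
  have "((\<lambda>x. radial_div (c0 - d) g x - radial_div c0 g x) has_integral
      (\<Sum>i<length vs. \<bar>cdet (c0 - d) i\<bar> * ?I i) - (\<Sum>i<length vs. \<bar>cdet c0 i\<bar> * ?I i)) K"
    by (intro has_integral_diff radial_divergence_theorem c1 centre0 g)
  moreover have "(\<lambda>x. radial_div (c0 - d) g x - radial_div c0 g x)
      = (\<lambda>x. partial_deriv 1 g x * d $ 1 + partial_deriv 2 g x * d $ 2)"
    by (auto simp: radial_div_def algebra_simps)
  moreover have "(\<Sum>i<length vs. \<bar>cdet (c0 - d) i\<bar> * ?I i) - (\<Sum>i<length vs. \<bar>cdet c0 i\<bar> * ?I i)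
      = (\<Sum>i<length vs. edge_length vs i * ((d \<bullet> nrm i) * ?I i))"
    unfolding sum_subtractf[symmetric] left_diff_distrib[symmetric]
    by (intro sum.cong) (simp_all add: abs_diff)
  ultimately show ?thesis by simp
qed

lemma divergence_theorem:
  assumes g: "C1 g"
  shows "integral\<^sup>L (lebesgue_on K) (partial_deriv j g) = L2_boundary_inner vs g (\<lambda>x. outward_normal K x $ j)"
proof -
  let ?I = "\<lambda>i. integral {0..1} (\<lambda>t. g (edge vs i t))"
  \<comment> \<open>Half the radius keeps the second centre in the ball; linearity in the direction
    allows the factor to be divided out below.\<close>
  let ?d = "(r0 / 2) *\<^sub>R axis j 1 :: real^2"
  have "norm ?d < r0" using r0 by simp
  have pd: "partial_deriv 1 g x * ?d $ 1 + partial_deriv 2 g x * ?d $ 2 = (r0 / 2) * partial_deriv j g x" for x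
    using exhaust_2[of j] by auto
  have dn: "?d \<bullet> nrm i = (r0 / 2) * nrm i $ j" for i
    by (simp add: inner_axis' )
  have "((\<lambda>x. (r0 / 2) * partial_deriv j g x) has_integral
      (\<Sum>i<length vs. edge_length vs i * (((r0 / 2) * nrm i $ j) * ?I i))) K"
    using divergence_theorem_direction[OF g \<open>norm ?d < r0\<close>] unfolding pd dn .
  then have "((\<lambda>x. (2 / r0) * ((r0 / 2) * partial_deriv j g x)) has_integral
      (2 / r0) * (\<Sum>i<length vs. edge_length vs i * (((r0 / 2) * nrm i $ j) * ?I i))) K"
    by (rule has_integral_mult_right)
  then have "(partial_deriv j g has_integral (\<Sum>i<length vs. edge_length vs i * (nrm i $ j * ?I i))) K"
    using r0 by (simp add: sum_distrib_left mult_ac)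
  then have "integral K (partial_deriv j g) = (\<Sum>i<length vs. edge_length vs i * (nrm i $ j * ?I i))"
    by (rule integral_unique)
  also have "\<dots> = L2_boundary_inner vs g (\<lambda>x. outward_normal K x $ j)"
    by (subst boundary_inner_continuous[OF centre0 C1_continuous_on[OF g], where G = "\<lambda>i x. nrm i $ j"])
       (auto simp: outward_normal_nrm mult.commute)
  also have "integral K (partial_deriv j g) = integral\<^sup>L (lebesgue_on K) (partial_deriv j g)"
    by (rule lebesgue_integral_eq_integral[symmetric])
       (auto intro: continuous_integrable_K C1_partial_continuous_on g)
  finally show ?thesis .
qed

end


section \<open>Square-integrable functions and integration by parts\<close>

text \<open>An arbitrary measure lets functions on \<open>K\<close> and functions of an edge
  parameter share the same lemmas.\<close>

definition sq_int :: "'a measure \<Rightarrow> ('a \<Rightarrow> 'b::euclidean_space) \<Rightarrow> bool" where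
  "sq_int M f \<longleftrightarrow> f \<in> borel_measurable M \<and> integrable M (\<lambda>x. (norm (f x))\<^sup>2)"

lemma sq_int_scaleR:
  assumes "sq_int M f"
  shows "sq_int M (\<lambda>x. a *\<^sub>R f x)"
  using assms by (auto simp: sq_int_def power_mult_distrib)

lemma sq_int_inner:
  assumes f: "sq_int M f" and g: "sq_int M g"
  shows "integrable M (\<lambda>x. f x \<bullet> g x)"
proof (rule Bochner_Integration.integrable_bound)
  show "integrable M (\<lambda>x. (norm (f x))\<^sup>2 + (norm (g x))\<^sup>2)"
    using f g by (simp add: sq_int_def)
  show "(\<lambda>x. f x \<bullet> g x) \<in> borel_measurable M"
    using f g unfolding sq_int_def by (intro borel_measurable_inner) auto
  show "AE x in M. norm (f x \<bullet> g x) \<le> norm ((norm (f x))\<^sup>2 + (norm (g x))\<^sup>2)"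
  proof (rule AE_I2)
    fix x
    have "\<bar>f x \<bullet> g x\<bar> \<le> norm (f x) * norm (g x)" by (rule Cauchy_Schwarz_ineq2)
    also have "\<dots> \<le> (norm (f x))\<^sup>2 + (norm (g x))\<^sup>2"
      using sum_squares_bound[of "norm (f x)" "norm (g x)"]
        mult_nonneg_nonneg[OF norm_ge_zero[of "f x"] norm_ge_zero[of "g x"]]
      by linarith
    finally show "norm (f x \<bullet> g x) \<le> norm ((norm (f x))\<^sup>2 + (norm (g x))\<^sup>2)" by simp
  qed
qed

lemma sq_int_add:
  assumes f: "sq_int M f" and g: "sq_int M g"
  shows "sq_int M (\<lambda>x. f x + g x)"
proof -
  have "integrable M (\<lambda>x. (norm (f x))\<^sup>2 + 2 * (f x \<bullet> g x) + (norm (g x))\<^sup>2)"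
    using f g sq_int_inner[OF f g] by (simp add: sq_int_def)
  moreover have "(norm (f x + g x))\<^sup>2 = (norm (f x))\<^sup>2 + 2 * (f x \<bullet> g x) + (norm (g x))\<^sup>2" for x
    by (simp add: power2_norm_eq_inner inner_add_left inner_add_right inner_commute)
  moreover have "(\<lambda>x. f x + g x) \<in> borel_measurable M"
    using f g unfolding sq_int_def by (intro borel_measurable_add) auto
  ultimately show ?thesis by (simp add: sq_int_def)
qed

lemma sq_int_inner_const:
  assumes "sq_int M f"
  shows "sq_int M (\<lambda>x. f x \<bullet> b)"
  unfolding sq_int_def
proof
  show m: "(\<lambda>x. f x \<bullet> b) \<in> borel_measurable M"
    using assms unfolding sq_int_def by (intro borel_measurable_inner) auto
  show "integrable M (\<lambda>x. (norm (f x \<bullet> b))\<^sup>2)"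
  proof (rule Bochner_Integration.integrable_bound)
    show "integrable M (\<lambda>x. (norm b)\<^sup>2 * (norm (f x))\<^sup>2)"
      using assms by (simp add: sq_int_def)
    show "(\<lambda>x. (norm (f x \<bullet> b))\<^sup>2) \<in> borel_measurable M" using m by simp
    have "(norm (f x \<bullet> b))\<^sup>2 \<le> (norm b * norm (f x))\<^sup>2" for x
      using Cauchy_Schwarz_ineq2[of "f x" b] by (intro power_mono) (simp_all add: mult.commute)
    then show "AE x in M. norm ((norm (f x \<bullet> b))\<^sup>2) \<le> norm ((norm b)\<^sup>2 * (norm (f x))\<^sup>2)"
      by (intro AE_I2) (simp add: power_mult_distrib)
  qed
qed

lemma L2_inner_commute: "L2_inner K f g = L2_inner K g f"
  by (simp add: L2_inner_def inner_commute)

lemma L2_inner_add_left: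
  fixes f g h :: "real^2 \<Rightarrow> 'b::euclidean_space"
  assumes "sq_int (lebesgue_on K) f" "sq_int (lebesgue_on K) g" "sq_int (lebesgue_on K) h"
  shows "L2_inner K (\<lambda>x. f x + g x) h = L2_inner K f h + L2_inner K g h"
  unfolding L2_inner_def inner_add_left
  by (intro Bochner_Integration.integral_add sq_int_inner assms)

lemma L2_inner_add_right:
  fixes f g h :: "real^2 \<Rightarrow> 'b::euclidean_space"
  assumes "sq_int (lebesgue_on K) f" "sq_int (lebesgue_on K) g" "sq_int (lebesgue_on K) h"
  shows "L2_inner K f (\<lambda>x. g x + h x) = L2_inner K f g + L2_inner K f h"
  using L2_inner_add_left[OF assms(2,3,1)] by (simp add: L2_inner_commute)

lemma L2_inner_scaleR:
  fixes f g :: "real^2 \<Rightarrow> 'b::euclidean_space"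
  shows "L2_inner K (\<lambda>x. a *\<^sub>R f x) g = a * L2_inner K f g"
    "L2_inner K f (\<lambda>x. a *\<^sub>R g x) = a * L2_inner K f g"
  unfolding L2_inner_def by simp_all

lemma L2_inner_cmult:
  "L2_inner K (\<lambda>x. a * f x) g = a * L2_inner K f g"
  "L2_inner K f (\<lambda>x. a * g x) = a * L2_inner K f g"
  unfolding L2_inner_def by (simp_all add: mult.assoc mult.left_commute)

lemma L2_boundary_inner_commute: "L2_boundary_inner vs f g = L2_boundary_inner vs g f"
  by (simp add: L2_boundary_inner_def mult.commute)

definition boundary_L2 :: "(real^2) list \<Rightarrow> (real^2 \<Rightarrow> real) \<Rightarrow> bool" where
  "boundary_L2 vs f \<longleftrightarrow> (\<forall>i<length vs. sq_int (lebesgue_on {0..1}) (\<lambda>t. f (edge vs i t)))"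

lemma boundary_L2_add:
  "boundary_L2 vs f \<Longrightarrow> boundary_L2 vs g \<Longrightarrow> boundary_L2 vs (\<lambda>x. f x + g x)"
  by (simp add: boundary_L2_def sq_int_add)

lemma boundary_L2_cmult: "boundary_L2 vs f \<Longrightarrow> boundary_L2 vs (\<lambda>x. a * f x)"
  using sq_int_scaleR[where 'b = real and a = a] by (auto simp: boundary_L2_def)

lemma L2_boundary_inner_add_left:
  assumes "boundary_L2 vs f" "boundary_L2 vs g" "boundary_L2 vs h"
  shows "L2_boundary_inner vs (\<lambda>x. f x + g x) h = L2_boundary_inner vs f h + L2_boundary_inner vs g h"
  unfolding L2_boundary_inner_def sum.distrib[symmetric]
proof (rule sum.cong[OF refl])
  fix i assume "i \<in> {..<length vs}"
  then have "integrable (lebesgue_on {0..1}) (\<lambda>t. f (edge vs i t) * h (edge vs i t))"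
    "integrable (lebesgue_on {0..1}) (\<lambda>t. g (edge vs i t) * h (edge vs i t))"
    using assms sq_int_inner[of "lebesgue_on {0..1}" "\<lambda>t. f (edge vs i t)" "\<lambda>t. h (edge vs i t)"]
      sq_int_inner[of "lebesgue_on {0..1}" "\<lambda>t. g (edge vs i t)" "\<lambda>t. h (edge vs i t)"]
    by (auto simp: boundary_L2_def)
  then show "edge_length vs i * (LINT t|lebesgue_on {0..1}. (f (edge vs i t) + g (edge vs i t)) * h (edge vs i t))
     = edge_length vs i * (LINT t|lebesgue_on {0..1}. f (edge vs i t) * h (edge vs i t))
     + edge_length vs i * (LINT t|lebesgue_on {0..1}. g (edge vs i t) * h (edge vs i t))"
    by (simp add: distrib_right distrib_left)
qed

lemma L2_boundary_inner_add_right: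
  assumes "boundary_L2 vs f" "boundary_L2 vs g" "boundary_L2 vs h"
  shows "L2_boundary_inner vs f (\<lambda>x. g x + h x) = L2_boundary_inner vs f g + L2_boundary_inner vs f h"
  using L2_boundary_inner_add_left[OF assms(2,3,1)] by (simp add: L2_boundary_inner_commute)

lemma L2_boundary_inner_cmult:
  "L2_boundary_inner vs (\<lambda>x. a * f x) g = a * L2_boundary_inner vs f g"
  "L2_boundary_inner vs f (\<lambda>x. a * g x) = a * L2_boundary_inner vs f g"
  unfolding L2_boundary_inner_def by (simp_all add: sum_distrib_left mult_ac)

section \<open>Polynomial vector fields under the differential operators\<close>

lemma vector_2_eq: "vector [a, b] = a *\<^sub>R axis 1 1 + b *\<^sub>R (axis 2 1 :: real^2)"
  by (simp add: vec_eq_iff forall_2 vector_2)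

lemma vec_poly_component: "u \<in> vec_poly_space k \<Longrightarrow> (\<lambda>x. u x $ i) \<in> poly_space k"
  by (simp add: vec_poly_space_def)

lemma vec_poly_continuous:
  assumes "u \<in> vec_poly_space k"
  shows "continuous_on A u"
proof -
  have "continuous_on A (\<lambda>x. u x $ 1 *\<^sub>R axis 1 1 + u x $ 2 *\<^sub>R (axis 2 1 :: real^2))"
    by (intro continuous_on_add continuous_on_scaleR continuous_on_const
        C1_continuous_on[OF poly_space_C1[OF vec_poly_component[OF assms]]])
  then show ?thesis by (simp only: vec_2_expand[symmetric])
qed

lemma poly_space_continuous: "p \<in> poly_space k \<Longrightarrow> continuous_on A p"
  by (intro C1_continuous_on poly_space_C1)

lemma grad_continuous: "p \<in> poly_space k \<Longrightarrow> continuous_on A (grad p)"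
  unfolding grad_def[abs_def] vector_2_eq
  by (intro continuous_intros C1_partial_continuous_on poly_space_C1)

lemma curl_continuous: "p \<in> poly_space k \<Longrightarrow> continuous_on A (curl p)"
  unfolding curl_def[abs_def] vector_2_eq
  by (intro continuous_intros C1_partial_continuous_on poly_space_C1)

lemma rot_in_poly_space: "z \<in> vec_poly_space k \<Longrightarrow> rot z \<in> poly_space k"
  unfolding rot_def[abs_def]
  by (intro poly_space_diff partial_deriv_in_poly_space vec_poly_component)

lemma divergence_in_poly_space: "z \<in> vec_poly_space k \<Longrightarrow> divergence z \<in> poly_space k"
  unfolding divergence_def[abs_def]
  by (intro poly_space_add partial_deriv_in_poly_space vec_poly_component)

lemma grad_add:
  "p \<in> poly_space k \<Longrightarrow> q \<in> poly_space k \<Longrightarrow> grad (\<lambda>x. p x + q x) = (\<lambda>x. grad p x + grad q x)"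
  by (auto simp: fun_eq_iff grad_def vec_eq_iff forall_2 vector_2 partial_deriv_add poly_space_differentiable)

lemma grad_cmult: "p \<in> poly_space k \<Longrightarrow> grad (\<lambda>x. a * p x) = (\<lambda>x. a *\<^sub>R grad p x)"
  by (auto simp: fun_eq_iff grad_def vec_eq_iff forall_2 vector_2 partial_deriv_cmult poly_space_differentiable)

lemma curl_add:
  "p \<in> poly_space k \<Longrightarrow> q \<in> poly_space k \<Longrightarrow> curl (\<lambda>x. p x + q x) = (\<lambda>x. curl p x + curl q x)"
  by (auto simp: fun_eq_iff curl_def vec_eq_iff forall_2 vector_2 partial_deriv_add poly_space_differentiable)

lemma curl_cmult: "p \<in> poly_space k \<Longrightarrow> curl (\<lambda>x. a * p x) = (\<lambda>x. a *\<^sub>R curl p x)"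
  by (auto simp: fun_eq_iff curl_def vec_eq_iff forall_2 vector_2 partial_deriv_cmult poly_space_differentiable)

lemma vec_poly_differentiable: "z \<in> vec_poly_space k \<Longrightarrow> (\<lambda>y. z y $ i) differentiable (at x)"
  by (rule poly_space_differentiable[OF vec_poly_component])

lemma rot_add:
  "y \<in> vec_poly_space k \<Longrightarrow> z \<in> vec_poly_space k \<Longrightarrow> rot (\<lambda>x. y x + z x) = (\<lambda>x. rot y x + rot z x)"
  by (auto simp: fun_eq_iff rot_def partial_deriv_add vec_poly_differentiable)

lemma rot_scaleR: "z \<in> vec_poly_space k \<Longrightarrow> rot (\<lambda>x. a *\<^sub>R z x) = (\<lambda>x. a * rot z x)"
  by (auto simp: fun_eq_iff rot_def partial_deriv_cmult vec_poly_differentiable algebra_simps)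

lemma divergence_add:
  "y \<in> vec_poly_space k \<Longrightarrow> z \<in> vec_poly_space k \<Longrightarrow>
    divergence (\<lambda>x. y x + z x) = (\<lambda>x. divergence y x + divergence z x)"
  by (auto simp: fun_eq_iff divergence_def partial_deriv_add vec_poly_differentiable)

lemma divergence_scaleR: "z \<in> vec_poly_space k \<Longrightarrow> divergence (\<lambda>x. a *\<^sub>R z x) = (\<lambda>x. a * divergence z x)"
  by (auto simp: fun_eq_iff divergence_def partial_deriv_cmult vec_poly_differentiable algebra_simps)

lemma vec_poly_zero: "(\<lambda>x. 0) \<in> vec_poly_space k"
  by (simp add: vec_poly_space_def poly_space_zero)

lemma poly_fields_triple:
  fixes w :: "real^2 \<Rightarrow> real \<times> real \<times> (real^2)"
  shows "w \<in> poly_fields k \<longleftrightarrow>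
    (\<lambda>x. fst (w x)) \<in> poly_space k \<and> (\<lambda>x. fst (snd (w x))) \<in> poly_space k \<and> (\<lambda>x. snd (snd (w x))) \<in> vec_poly_space k"
  by (auto simp: poly_fields_def Basis_prod_def ball_Un Basis_real2 inner_prod_def inner_axis
      vec_poly_space_def forall_2)

text \<open>The part of \<open>K\<close> where \<open>g\<close> is nonzero is both open and
  negligible, hence empty.\<close>

lemma integral_zero_open:
  fixes g :: "real^2 \<Rightarrow> real"
  assumes K: "open K" and g: "continuous_on UNIV g" "\<And>x. 0 \<le> g x"
    and int: "integrable (lebesgue_on K) g" "integral\<^sup>L (lebesgue_on K) g = 0" and x: "x \<in> K"
  shows "g x = 0"
proof -
  have "AE x in lebesgue_on K. g x = 0"
    using integral_nonneg_eq_0_iff_AE[OF int(1)] int(2) g(2) by simp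
  then have "AE x in lebesgue. x \<in> K \<longrightarrow> g x = 0"
    using K by (subst (asm) AE_restrict_space_iff) auto
  then have AE: "AE x in lebesgue. x \<notin> K \<inter> {x. g x \<noteq> 0}"
    by (rule AE_mp) auto
  have op: "open (K \<inter> {x. g x \<noteq> 0})"
    using K g(1) by (intro open_Int open_Collect_neq) (auto intro: continuous_intros)
  then have "negligible (K \<inter> {x. g x \<noteq> 0})"
    using AE by (simp add: negligible_iff_null_sets AE_iff_null_sets)
  then have "K \<inter> {x. g x \<noteq> 0} = {}"
    using open_not_negligible[OF op] by blast
  then show ?thesis using x by blast
qed

context star_element
begin

abbreviation "n \<equiv> outward_normal K"

lemma sq_int_continuous:
  fixes g :: "real^2 \<Rightarrow> 'b::euclidean_space"
  assumes "continuous_on UNIV g"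
  shows "sq_int (lebesgue_on K) g"
proof -
  have "integrable (lebesgue_on K) (\<lambda>x. (norm (g x))\<^sup>2)"
    by (intro continuous_integrable_K continuous_intros assms)
  moreover have "g \<in> borel_measurable (lebesgue_on K)"
    using continuous_integrable_K[OF assms] by (rule borel_measurable_integrable)
  ultimately show ?thesis by (simp add: sq_int_def)
qed

lemma L2_boundary_fun_continuous:
  assumes "continuous_on UNIV u"
  shows "L2_boundary_fun vs u"
  unfolding L2_boundary_fun_def
proof (intro allI impI conjI)
  fix i
  have c: "continuous_on {0..1} (\<lambda>t. u (edge vs i t))"
    by (rule continuous_on_compose2[OF assms edge_continuous]) auto
  then show "(\<lambda>t. u (edge vs i t)) \<in> borel_measurable (lebesgue_on {0..1})"
    by (intro borel_measurable_integrable continuous_imp_integrable_real)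
  show "integrable (lebesgue_on {0..1}) (\<lambda>t. (norm (u (edge vs i t)))\<^sup>2)"
    by (intro continuous_imp_integrable_real continuous_intros c)
qed

lemma boundary_L2_continuous:
  assumes "continuous_on UNIV f"
  shows "boundary_L2 vs f"
  unfolding boundary_L2_def sq_int_def
proof (intro allI impI conjI)
  fix i
  have c: "continuous_on {0..1} (\<lambda>t. f (edge vs i t))"
    by (rule continuous_on_compose2[OF assms edge_continuous]) auto
  then show "(\<lambda>t. f (edge vs i t)) \<in> borel_measurable (lebesgue_on {0..1})"
    by (intro borel_measurable_integrable continuous_imp_integrable_real)
  show "integrable (lebesgue_on {0..1}) (\<lambda>t. (norm (f (edge vs i t)))\<^sup>2)"
    by (intro continuous_imp_integrable_real continuous_intros c)
qed

lemma sq_int_spike: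
  fixes f g :: "real \<Rightarrow> real"
  assumes "\<And>t. 0 < t \<Longrightarrow> t < 1 \<Longrightarrow> f t = g t" "sq_int (lebesgue_on {0..1}) g"
  shows "sq_int (lebesgue_on {0..1}) f"
proof -
  have i: "integrable (lebesgue_on {0..1}) (\<lambda>t. (norm (g t))\<^sup>2)"
    and m: "g \<in> borel_measurable (lebesgue_on {0..1})"
    using assms(2) by (simp_all add: sq_int_def)
  have "integrable (lebesgue_on {0..1}) (\<lambda>t. (norm (f t))\<^sup>2)"
    by (rule lebesgue_on_01_spike(3)[OF _ borel_measurable_integrable[OF i] i]) (simp only: assms(1))
  moreover have "f \<in> borel_measurable (lebesgue_on {0..1})"
    by (rule lebesgue_on_01_spike(1)[OF assms(1) m])
  ultimately show ?thesis by (simp add: sq_int_def)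
qed

text \<open>Between corners the normal is constant on each edge, so these functions agree there with
  a fixed component of \<open>u\<close>.\<close>

lemma boundary_L2_normal:
  assumes "L2_boundary_fun vs u"
  shows "boundary_L2 vs (\<lambda>x. u x \<bullet> n x)" "boundary_L2 vs (\<lambda>x. u x \<bullet> perp (n x))"
  unfolding boundary_L2_def
proof (safe)
  fix i assume i: "i < length vs"
  have u: "sq_int (lebesgue_on {0..1}) (\<lambda>t. u (edge vs i t))"
    using assms i by (simp add: L2_boundary_fun_def sq_int_def)
  show "sq_int (lebesgue_on {0..1}) (\<lambda>t. u (edge vs i t) \<bullet> n (edge vs i t))"
    by (rule sq_int_spike[OF _ sq_int_inner_const[OF u, of "nrm i"]]) (simp add: outward_normal_nrm i)
  show "sq_int (lebesgue_on {0..1}) (\<lambda>t. u (edge vs i t) \<bullet> perp (n (edge vs i t)))"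
    by (rule sq_int_spike[OF _ sq_int_inner_const[OF u, of "perp (nrm i)"]]) (simp add: outward_normal_nrm i)
qed

text \<open>A bounded nonempty set has a frontier, so there is at least one edge. This provides a
  boundary point at which a constant can be evaluated.\<close>

lemma length_vs: "length vs > 0"
proof (rule ccontr)
  assume "\<not> length vs > 0"
  then have "frontier K = {}" using frontier_K by simp
  moreover have "K \<noteq> UNIV" using bounded_K not_bounded_UNIV by auto
  ultimately show False using nonempty_K frontier_eq_empty by blast
qed

lemma integral_by_parts:
  assumes "C1 p" "C1 q"
  shows "L2_inner K p (partial_deriv j q) + L2_inner K (partial_deriv j p) q
    = L2_boundary_inner vs (\<lambda>x. p x * q x) (\<lambda>x. n x $ j)"
proof -
  have "L2_inner K p (partial_deriv j q) + L2_inner K (partial_deriv j p) q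
      = integral\<^sup>L (lebesgue_on K) (\<lambda>x. p x * partial_deriv j q x + partial_deriv j p x * q x)"
    unfolding L2_inner_def inner_real_def
    by (intro Bochner_Integration.integral_add[symmetric] continuous_integrable_K continuous_intros
        C1_continuous_on C1_partial_continuous_on assms)
  also have "\<dots> = integral\<^sup>L (lebesgue_on K) (partial_deriv j (\<lambda>x. p x * q x))"
    using assms by (intro arg_cong[where f = "integral\<^sup>L _"] ext) (simp add: partial_deriv_mult C1_differentiable)
  also have "\<dots> = L2_boundary_inner vs (\<lambda>x. p x * q x) (\<lambda>x. n x $ j)"
    by (rule divergence_theorem[OF C1_mult[OF assms]])
  finally show ?thesis .
qed

lemma L2_inner_vec:
  fixes f g :: "real^2 \<Rightarrow> real^2"
  assumes "continuous_on UNIV f" "continuous_on UNIV g"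
  shows "L2_inner K f g = L2_inner K (\<lambda>x. f x $ 1) (\<lambda>x. g x $ 1) + L2_inner K (\<lambda>x. f x $ 2) (\<lambda>x. g x $ 2)"
  unfolding L2_inner_def inner_2 inner_real_def
  by (intro Bochner_Integration.integral_add continuous_integrable_K continuous_intros
      continuous_on_compose2[OF _ assms(1)] continuous_on_compose2[OF _ assms(2)] assms)

lemma L2_boundary_inner_shift:
  "L2_boundary_inner vs (\<lambda>x. p x * q x) m = L2_boundary_inner vs p (\<lambda>x. q x * m x)"
  unfolding L2_boundary_inner_def by (simp add: mult.assoc)

lemma boundary_L2_component_mult:
  assumes "continuous_on UNIV q"
  shows "boundary_L2 vs (\<lambda>x. q x * n x $ j)"
proof -
  have "boundary_L2 vs (\<lambda>x. (q x *\<^sub>R axis j 1) \<bullet> n x)"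
    by (intro boundary_L2_normal L2_boundary_fun_continuous continuous_intros assms)
  then show ?thesis by (simp add: inner_axis')
qed

lemma div_by_parts:
  assumes p: "p \<in> poly_space k" and z: "z \<in> vec_poly_space k"
  shows "L2_boundary_inner vs p (\<lambda>x. z x \<bullet> n x) - L2_inner K p (divergence z) = L2_inner K z (grad p)"
proof -
  note C = poly_space_C1[OF p] poly_space_C1[OF vec_poly_component[OF z]]
  note cont = C1_continuous_on[OF C(1)] C1_continuous_on[OF C(2)]
    C1_partial_continuous_on[OF C(1)] C1_partial_continuous_on[OF C(2)]
  have g: "L2_inner K z (grad p) = L2_inner K (\<lambda>x. z x $ 1) (partial_deriv 1 p) + L2_inner K (\<lambda>x. z x $ 2) (partial_deriv 2 p)"
    by (subst L2_inner_vec[OF vec_poly_continuous[OF z] grad_continuous[OF p]]) (simp add: grad_def vector_2)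
  have d: "L2_inner K p (divergence z)
      = L2_inner K p (partial_deriv 1 (\<lambda>y. z y $ 1)) + L2_inner K p (partial_deriv 2 (\<lambda>y. z y $ 2))"
    unfolding divergence_def[abs_def] by (intro L2_inner_add_right sq_int_continuous cont)
  have b: "L2_boundary_inner vs p (\<lambda>x. z x \<bullet> n x)
      = L2_boundary_inner vs (\<lambda>x. p x * z x $ 1) (\<lambda>x. n x $ 1) + L2_boundary_inner vs (\<lambda>x. p x * z x $ 2) (\<lambda>x. n x $ 2)"
    unfolding inner_2 L2_boundary_inner_shift
    by (intro L2_boundary_inner_add_right boundary_L2_continuous boundary_L2_component_mult cont)
  show ?thesis
    unfolding g d b
    using integral_by_parts[OF C, of 1 1] integral_by_parts[OF C, of 2 2]
    by (simp add: L2_inner_commute)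
qed

text \<open>This is \<open>div_by_parts\<close> for the rotated field \<open>perp (z x)\<close>: its
  divergence is \<open>rot z\<close>, while its products with \<open>n\<close> and with
  \<open>grad p\<close> are those of \<open>z\<close> with \<open>perp (n x)\<close> and
  \<open>curl p\<close>, up to sign.\<close>

lemma rot_by_parts:
  assumes p: "p \<in> poly_space k" and z: "z \<in> vec_poly_space k"
  shows "L2_inner K p (rot z) + L2_boundary_inner vs p (\<lambda>x. z x \<bullet> perp (n x)) = L2_inner K z (curl p)"
proof -
  define y where "y = (\<lambda>x. perp (z x))"
  have y: "y \<in> vec_poly_space k"
    using z poly_space_cmult[OF vec_poly_component[OF z], of "-1" 1]
    by (auto simp: vec_poly_space_def y_def perp_def forall_2 vector_2)
  have "divergence y = rot z"
    using partial_deriv_cmult[OF vec_poly_differentiable[OF z], of 2 "-1" 1]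
    by (auto simp: fun_eq_iff divergence_def rot_def y_def perp_def vector_2)
  moreover have "(\<lambda>x. y x \<bullet> n x) = (\<lambda>x. (- 1) * (z x \<bullet> perp (n x)))"
    by (simp add: y_def inner_2 perp_def vector_2 fun_eq_iff)
  moreover have "L2_inner K y (grad p) = - L2_inner K z (curl p)"
  proof -
    have "y x \<bullet> grad p x = - (z x \<bullet> curl p x)" for x
      by (simp add: y_def inner_2 perp_def grad_def curl_def vector_2)
    then show ?thesis by (simp add: L2_inner_def)
  qed
  ultimately show ?thesis
    using div_by_parts[OF p y] by (simp only: L2_boundary_inner_cmult)
qed

lemma L2_inner_self_zero:
  fixes p :: "real^2 \<Rightarrow> real"
  assumes p: "p \<in> poly_space k" and 0: "L2_inner K p p = 0"
  shows "p x = 0"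
proof (rule poly_space_vanishes[OF p open_K])
  show "K \<noteq> {}" by (rule nonempty_K)
  fix x assume "x \<in> K"
  have c: "continuous_on UNIV (\<lambda>x. p x * p x)"
    by (intro continuous_intros poly_space_continuous[OF p])
  have "p x * p x = 0"
    by (rule integral_zero_open[OF open_K c _ continuous_integrable_K[OF c] _ \<open>x \<in> K\<close>])
       (use 0 in \<open>simp_all add: L2_inner_def\<close>)
  then show "p x = 0" by simp
qed

lemma L2_inner_self_nonneg: "L2_inner K p p \<ge> 0"
  unfolding L2_inner_def by (intro integral_nonneg_AE) simp

lemma L2_boundary_inner_self_nonneg: "L2_boundary_inner vs p p \<ge> 0"
  unfolding L2_boundary_inner_def edge_length_def
  by (intro sum_nonneg mult_nonneg_nonneg integral_nonneg_AE) simp_all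

text \<open>The conclusion concerns the continuous representative and thus includes the ends of the
  edge, where \<open>F\<close> itself is not controlled.\<close>

lemma L2_boundary_inner_self_zero:
  assumes F: "\<And>i t. i < length vs \<Longrightarrow> 0 < t \<Longrightarrow> t < 1 \<Longrightarrow> F (edge vs i t) = G i (edge vs i t)"
    and G: "\<And>i. i < length vs \<Longrightarrow> continuous_on UNIV (G i)"
    and 0: "L2_boundary_inner vs F F = 0"
    and i: "i < length vs" and t: "0 \<le> t" "t \<le> 1"
  shows "G i (edge vs i t) = 0"
proof -
  let ?J = "\<lambda>i. integral\<^sup>L (lebesgue_on {0..1}) (\<lambda>t. F (edge vs i t) * F (edge vs i t))"
  have "\<forall>i\<in>{..<length vs}. edge_length vs i * ?J i = 0"
    using 0 unfolding L2_boundary_inner_def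
    by (subst (asm) sum_nonneg_eq_0_iff)
       (auto simp: edge_length_def intro!: mult_nonneg_nonneg integral_nonneg_AE)
  moreover have "edge_length vs i \<noteq> 0" using edge_ends[OF i] by (simp add: edge_length_eq)
  ultimately have J: "?J i = 0" using i by auto
  let ?h = "\<lambda>t. G i (edge vs i t) * G i (edge vs i t)"
  have c: "continuous_on {0..1} ?h"
    by (intro continuous_intros continuous_on_compose2[OF G[OF i] edge_continuous]) auto
  have int: "integrable (lebesgue_on {0..1}) ?h"
    using continuous_imp_integrable_real[OF c] .
  have "integral {0..1} ?h = integral\<^sup>L (lebesgue_on {0..1}) ?h"
    by (rule lebesgue_integral_eq_integral[OF int, symmetric]) simp
  also have "\<dots> = ?J i"
    using F[OF i] int by (intro lebesgue_on_01_spike(2)[symmetric]) auto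
  finally have "integral {0..1} ?h = 0" using J by simp
  then have "?h t = 0"
    using integral_eq_0_iff[OF c] t by auto
  then show ?thesis by simp
qed

lemma boundary_inner_vanishing:
  assumes "\<And>i t. i < length vs \<Longrightarrow> 0 \<le> t \<Longrightarrow> t \<le> 1 \<Longrightarrow> f (edge vs i t) = 0"
  shows "L2_boundary_inner vs f g = 0"
  unfolding L2_boundary_inner_def
proof (rule sum.neutral, rule ballI)
  fix i assume "i \<in> {..<length vs}"
  then have "integral\<^sup>L (lebesgue_on {0..1}) (\<lambda>t. f (edge vs i t) * g (edge vs i t))
      = integral\<^sup>L (lebesgue_on {0..1::real}) (\<lambda>t. 0)"
    by (intro Bochner_Integration.integral_cong) (auto simp: assms)
  then show "edge_length vs i * integral\<^sup>L (lebesgue_on {0..1}) (\<lambda>t. f (edge vs i t) * g (edge vs i t)) = 0"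
    by simp
qed

text \<open>Energy argument: the product of \<open>p\<close> with its Laplacian is integrated by
  parts, the boundary term vanishes, and so the gradient has norm zero. The remaining constant
  equals the boundary value.\<close>

lemma harmonic_poly_zero:
  assumes p: "p \<in> poly_space k"
    and harm: "\<And>x. partial_deriv 1 (partial_deriv 1 p) x + partial_deriv 2 (partial_deriv 2 p) x = 0"
    and bd: "\<And>i t. i < length vs \<Longrightarrow> 0 \<le> t \<Longrightarrow> t \<le> 1 \<Longrightarrow> p (edge vs i t) = 0"
  shows "p x = 0"
proof -
  have dp: "partial_deriv j p \<in> poly_space k" for j
    by (rule partial_deriv_in_poly_space[OF p])
  have parts: "L2_inner K p (partial_deriv j (partial_deriv j p)) + L2_inner K (partial_deriv j p) (partial_deriv j p) = 0" for j
    unfolding integral_by_parts[OF poly_space_C1[OF p] poly_space_C1[OF dp]]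
    by (rule boundary_inner_vanishing) (simp add: bd)
  have "L2_inner K p (partial_deriv 1 (partial_deriv 1 p)) + L2_inner K p (partial_deriv 2 (partial_deriv 2 p))
      = L2_inner K p (\<lambda>x. partial_deriv 1 (partial_deriv 1 p) x + partial_deriv 2 (partial_deriv 2 p) x)"
    by (intro L2_inner_add_right[symmetric] sq_int_continuous poly_space_continuous[OF p]
        poly_space_continuous[OF partial_deriv_in_poly_space[OF dp]])
  also have "\<dots> = 0" by (simp add: harm L2_inner_def)
  finally have "L2_inner K (partial_deriv 1 p) (partial_deriv 1 p) = 0 \<and> L2_inner K (partial_deriv 2 p) (partial_deriv 2 p) = 0"
    using parts[of 1] parts[of 2] L2_inner_self_nonneg[of "partial_deriv 1 p"] L2_inner_self_nonneg[of "partial_deriv 2 p"]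
    by linarith
  then have "partial_deriv j p y = 0" for j y
    using L2_inner_self_zero[OF dp] exhaust_2[of j] by auto
  then have "p x = p (edge vs 0 0)"
    by (intro constant_of_partial_deriv_zero poly_space_differentiable[OF p])
  then show ?thesis using bd[of 0 0] length_vs by simp
qed

end


section \<open>The local problem\<close>

lemma orthonormal_frame_zero:
  assumes "norm m = 1" "v \<bullet> m = 0" "v \<bullet> perp m = 0"
  shows "v = 0"
proof -
  have "(v \<bullet> v) * (m \<bullet> m) = (v \<bullet> m)\<^sup>2 + (v \<bullet> perp m)\<^sup>2"
    by (simp add: inner_2 perp_def vector_2 power2_eq_square algebra_simps)
  then show ?thesis using assms by (auto simp: norm_eq_1)
qed

context star_element
begin

definition "form_sigma \<sigma> u \<eta> = L2_inner K \<sigma> \<eta> - L2_inner K u (curl \<eta>)"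

definition "form_phi \<phi> u \<psi> = L2_inner K \<phi> \<psi> - L2_inner K u (grad \<psi>)"

text \<open>The numerical traces are expanded: the terms linear in the unknowns stay here, and those
  with the boundary data go to the other side, into \<open>load_u\<close>.\<close>

definition "form_u \<alpha> \<tau> \<sigma> \<phi> u z =
  L2_inner K \<sigma> (rot z) + L2_boundary_inner vs \<sigma> (\<lambda>x. z x \<bullet> perp (n x))
  + inverse \<alpha> * L2_boundary_inner vs (\<lambda>x. u x \<bullet> perp (n x)) (\<lambda>x. z x \<bullet> perp (n x))
  - L2_inner K \<phi> (divergence z) + L2_boundary_inner vs \<phi> (\<lambda>x. z x \<bullet> n x)
  + inverse \<tau> * L2_boundary_inner vs (\<lambda>x. u x \<bullet> n x) (\<lambda>x. z x \<bullet> n x)"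

definition "load_u \<alpha> \<tau> f uc uh z = L2_inner K f z
  + inverse \<alpha> * L2_boundary_inner vs (\<lambda>x. uc x \<bullet> perp (n x)) (\<lambda>x. z x \<bullet> perp (n x))
  + inverse \<tau> * L2_boundary_inner vs (\<lambda>x. uh x \<bullet> n x) (\<lambda>x. z x \<bullet> n x)"

lemma homogeneous_zero:
  assumes "\<alpha> > 0" "\<tau> > 0"
    and \<sigma>: "\<sigma> \<in> poly_space k" and \<phi>: "\<phi> \<in> poly_space k" and u: "u \<in> vec_poly_space k"
    and h1: "\<And>\<eta>. \<eta> \<in> poly_space k \<Longrightarrow> form_sigma \<sigma> u \<eta> = 0"
    and h2: "\<And>\<psi>. \<psi> \<in> poly_space k \<Longrightarrow> form_phi \<phi> u \<psi> = 0"
    and h3: "\<And>z. z \<in> vec_poly_space k \<Longrightarrow> form_u \<alpha> \<tau> \<sigma> \<phi> u z = 0"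
  shows "\<sigma> x = 0 \<and> \<phi> x = 0 \<and> u x = 0"
proof -
  let ?B = "L2_boundary_inner vs"
  let ?t = "\<lambda>x. u x \<bullet> perp (n x)" and ?m = "\<lambda>x. u x \<bullet> n x"
  \<comment> \<open>The three equations tested with the solution are added. By
    \<open>rot_by_parts\<close> and \<open>div_by_parts\<close> the coupling terms of the third
    cancel those of the first two.\<close>
  have "L2_inner K \<sigma> \<sigma> + L2_inner K \<phi> \<phi> + inverse \<alpha> * ?B ?t ?t + inverse \<tau> * ?B ?m ?m = 0"
    using h1[OF \<sigma>] h2[OF \<phi>] h3[OF u] rot_by_parts[OF \<sigma> u] div_by_parts[OF \<phi> u]
    unfolding form_sigma_def form_phi_def form_u_def by linarith
  moreover have "inverse \<alpha> * ?B ?t ?t \<ge> 0" "inverse \<tau> * ?B ?m ?m \<ge> 0"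
    using assms(1,2) L2_boundary_inner_self_nonneg by simp_all
  ultimately have 0: "L2_inner K \<sigma> \<sigma> = 0" "L2_inner K \<phi> \<phi> = 0"
    "inverse \<alpha> * ?B ?t ?t = 0" "inverse \<tau> * ?B ?m ?m = 0"
    using L2_inner_self_nonneg[of \<sigma>] L2_inner_self_nonneg[of \<phi>] by linarith+
  have \<sigma>0: "\<sigma> x = 0" and \<phi>0: "\<phi> x = 0" for x
    using L2_inner_self_zero[OF \<sigma> 0(1)] L2_inner_self_zero[OF \<phi> 0(2)] by simp_all
  have B: "?B ?t ?t = 0" "?B ?m ?m = 0" using 0 assms(1,2) by simp_all
  have u_edge: "u (edge vs i t) = 0" if i: "i < length vs" and t: "0 \<le> t" "t \<le> 1" for i t
  proof (rule orthonormal_frame_zero[OF norm_nrm[OF i]])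
    show "u (edge vs i t) \<bullet> nrm i = 0"
      by (rule L2_boundary_inner_self_zero[OF _ _ B(2) i t, of "\<lambda>i x. u x \<bullet> nrm i"])
         (auto simp: outward_normal_nrm intro!: continuous_intros vec_poly_continuous[OF u])
    show "u (edge vs i t) \<bullet> perp (nrm i) = 0"
      by (rule L2_boundary_inner_self_zero[OF _ _ B(1) i t, of "\<lambda>i x. u x \<bullet> perp (nrm i)"])
         (auto simp: outward_normal_nrm intro!: continuous_intros vec_poly_continuous[OF u])
  qed
  \<comment> \<open>\<open>divergence u\<close> itself is the test function in the second equation,
    where \<open>\<phi>\<close> is already zero; integration by parts produces its squared norm
    because \<open>u\<close> vanishes on the boundary.\<close>
  have div0: "divergence u x = 0" for x
  proof (rule L2_inner_self_zero[OF divergence_in_poly_space[OF u]])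
    have "?B (divergence u) ?m = 0"
      by (subst L2_boundary_inner_commute) (rule boundary_inner_vanishing, simp add: u_edge)
    moreover have "L2_inner K u (grad (divergence u)) = 0"
      using h2[OF divergence_in_poly_space[OF u]] by (simp add: form_phi_def L2_inner_def \<phi>0)
    ultimately show "L2_inner K (divergence u) (divergence u) = 0"
      using div_by_parts[OF divergence_in_poly_space[OF u] u] by simp
  qed
  have rot0: "rot u x = 0" for x
  proof (rule L2_inner_self_zero[OF rot_in_poly_space[OF u]])
    have "?B (rot u) ?t = 0"
      by (subst L2_boundary_inner_commute) (rule boundary_inner_vanishing, simp add: u_edge)
    moreover have "L2_inner K u (curl (rot u)) = 0"
      using h1[OF rot_in_poly_space[OF u]] by (simp add: form_sigma_def L2_inner_def \<sigma>0)
    ultimately show "L2_inner K (rot u) (rot u) = 0"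
      using rot_by_parts[OF rot_in_poly_space[OF u] u] by simp
  qed
  let ?u1 = "\<lambda>x. u x $ 1" and ?u2 = "\<lambda>x. u x $ 2"
  note P = vec_poly_component[OF u]
  note dP = poly_space_differentiable[OF partial_deriv_in_poly_space[OF P]]
  \<comment> \<open>Relations of Cauchy-Riemann type. Differentiating them and commuting the mixed
    derivatives makes both components harmonic.\<close>
  have cr: "partial_deriv 1 ?u1 = (\<lambda>x. (- 1) * partial_deriv 2 ?u2 x)"
    "partial_deriv 2 ?u2 = (\<lambda>x. (- 1) * partial_deriv 1 ?u1 x)"
    "partial_deriv 2 ?u1 = partial_deriv 1 ?u2"
    using div0 rot0 by (auto simp: fun_eq_iff divergence_def rot_def eq_neg_iff_add_eq_0 add.commute)
  have "?u1 x = 0"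
  proof (rule harmonic_poly_zero[OF P])
    show "partial_deriv 1 (partial_deriv 1 ?u1) x + partial_deriv 2 (partial_deriv 2 ?u1) x = 0" for x
      unfolding cr(1,3) partial_deriv_cmult[OF dP]
      using partial_deriv_commute[OF P, of 1 2 2 x] by simp
  qed (simp add: u_edge)
  moreover have "?u2 x = 0"
  proof (rule harmonic_poly_zero[OF P])
    show "partial_deriv 1 (partial_deriv 1 ?u2) x + partial_deriv 2 (partial_deriv 2 ?u2) x = 0" for x
      unfolding cr(2) cr(3)[symmetric] partial_deriv_cmult[OF dP]
      using partial_deriv_commute[OF P, of 1 2 1 x] by simp
  qed (simp add: u_edge)
  ultimately show ?thesis using \<sigma>0 \<phi>0 by (simp add: vec_eq_iff forall_2)
qed

section \<open>Bilinearity of the forms and linearity of the load\<close>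

lemma poly_sq_int:
  "p \<in> poly_space k \<Longrightarrow> sq_int (lebesgue_on K) p"
  "p \<in> poly_space k \<Longrightarrow> sq_int (lebesgue_on K) (grad p)"
  "p \<in> poly_space k \<Longrightarrow> sq_int (lebesgue_on K) (curl p)"
  "z \<in> vec_poly_space k \<Longrightarrow> sq_int (lebesgue_on K) z"
  "z \<in> vec_poly_space k \<Longrightarrow> sq_int (lebesgue_on K) (rot z)"
  "z \<in> vec_poly_space k \<Longrightarrow> sq_int (lebesgue_on K) (divergence z)"
  by (auto intro!: sq_int_continuous
      intro: poly_space_continuous grad_continuous curl_continuous vec_poly_continuous
        rot_in_poly_space divergence_in_poly_space)

lemma poly_boundary_L2:
  "p \<in> poly_space k \<Longrightarrow> boundary_L2 vs p"
  "z \<in> vec_poly_space k \<Longrightarrow> boundary_L2 vs (\<lambda>x. z x \<bullet> n x)"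
  "z \<in> vec_poly_space k \<Longrightarrow> boundary_L2 vs (\<lambda>x. z x \<bullet> perp (n x))"
  by (auto intro!: boundary_L2_continuous boundary_L2_normal L2_boundary_fun_continuous
      intro: poly_space_continuous vec_poly_continuous)

lemma form_sigma_add_left:
  assumes "p \<in> poly_space k" "p' \<in> poly_space k" "u \<in> vec_poly_space k" "u' \<in> vec_poly_space k" "q \<in> poly_space k"
  shows "form_sigma (\<lambda>x. p x + p' x) (\<lambda>x. u x + u' x) q = form_sigma p u q + form_sigma p' u' q"
  unfolding form_sigma_def
  using poly_sq_int(1)[OF assms(1)] poly_sq_int(1)[OF assms(2)] poly_sq_int(4)[OF assms(3)]
    poly_sq_int(4)[OF assms(4)] poly_sq_int(1,2,3)[OF assms(5)]
  by (simp add: L2_inner_add_left)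

lemma form_sigma_add_right:
  assumes "p \<in> poly_space k" "u \<in> vec_poly_space k" "q \<in> poly_space k" "q' \<in> poly_space k"
  shows "form_sigma p u (\<lambda>x. q x + q' x) = form_sigma p u q + form_sigma p u q'"
  unfolding form_sigma_def curl_add[OF assms(3,4)]
  using poly_sq_int(1)[OF assms(1)] poly_sq_int(4)[OF assms(2)]
    poly_sq_int(1,2,3)[OF assms(3)] poly_sq_int(1,2,3)[OF assms(4)]
  by (simp add: L2_inner_add_right)

lemma form_sigma_scale:
  "form_sigma (\<lambda>x. a * p x) (\<lambda>x. a *\<^sub>R u x) q = a * form_sigma p u q"
  "q \<in> poly_space k \<Longrightarrow> form_sigma p u (\<lambda>x. a * q x) = a * form_sigma p u q"
  by (simp_all add: form_sigma_def curl_cmult L2_inner_cmult L2_inner_scaleR right_diff_distrib)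

lemma form_phi_add_left:
  assumes "p \<in> poly_space k" "p' \<in> poly_space k" "u \<in> vec_poly_space k" "u' \<in> vec_poly_space k" "q \<in> poly_space k"
  shows "form_phi (\<lambda>x. p x + p' x) (\<lambda>x. u x + u' x) q = form_phi p u q + form_phi p' u' q"
  unfolding form_phi_def
  using poly_sq_int(1)[OF assms(1)] poly_sq_int(1)[OF assms(2)] poly_sq_int(4)[OF assms(3)]
    poly_sq_int(4)[OF assms(4)] poly_sq_int(1,2,3)[OF assms(5)]
  by (simp add: L2_inner_add_left)

lemma form_phi_add_right:
  assumes "p \<in> poly_space k" "u \<in> vec_poly_space k" "q \<in> poly_space k" "q' \<in> poly_space k"
  shows "form_phi p u (\<lambda>x. q x + q' x) = form_phi p u q + form_phi p u q'"
  unfolding form_phi_def grad_add[OF assms(3,4)]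
  using poly_sq_int(1)[OF assms(1)] poly_sq_int(4)[OF assms(2)]
    poly_sq_int(1,2,3)[OF assms(3)] poly_sq_int(1,2,3)[OF assms(4)]
  by (simp add: L2_inner_add_right)

lemma form_phi_scale:
  "form_phi (\<lambda>x. a * p x) (\<lambda>x. a *\<^sub>R u x) q = a * form_phi p u q"
  "q \<in> poly_space k \<Longrightarrow> form_phi p u (\<lambda>x. a * q x) = a * form_phi p u q"
  by (simp_all add: form_phi_def grad_cmult L2_inner_cmult L2_inner_scaleR right_diff_distrib)

lemma form_u_add_left:
  assumes \<sigma>: "\<sigma> \<in> poly_space k" "\<sigma>' \<in> poly_space k" and \<phi>: "\<phi> \<in> poly_space k" "\<phi>' \<in> poly_space k"
    and u: "u \<in> vec_poly_space k" "u' \<in> vec_poly_space k" and z: "z \<in> vec_poly_space k"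
  shows "form_u \<alpha> \<tau> (\<lambda>x. \<sigma> x + \<sigma>' x) (\<lambda>x. \<phi> x + \<phi>' x) (\<lambda>x. u x + u' x) z
      = form_u \<alpha> \<tau> \<sigma> \<phi> u z + form_u \<alpha> \<tau> \<sigma>' \<phi>' u' z"
  unfolding form_u_def inner_add_left
  using poly_sq_int(1)[OF \<sigma>(1)] poly_sq_int(1)[OF \<sigma>(2)] poly_sq_int(1)[OF \<phi>(1)] poly_sq_int(1)[OF \<phi>(2)]
    poly_sq_int(5,6)[OF z]
    poly_boundary_L2(1)[OF \<sigma>(1)] poly_boundary_L2(1)[OF \<sigma>(2)] poly_boundary_L2(1)[OF \<phi>(1)] poly_boundary_L2(1)[OF \<phi>(2)]
    poly_boundary_L2(2,3)[OF u(1)] poly_boundary_L2(2,3)[OF u(2)] poly_boundary_L2(2,3)[OF z]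
  by (simp add: L2_inner_add_left L2_boundary_inner_add_left algebra_simps)

lemma form_u_add_right:
  assumes \<sigma>: "\<sigma> \<in> poly_space k" and \<phi>: "\<phi> \<in> poly_space k"
    and u: "u \<in> vec_poly_space k" and z: "z \<in> vec_poly_space k" "z' \<in> vec_poly_space k"
  shows "form_u \<alpha> \<tau> \<sigma> \<phi> u (\<lambda>x. z x + z' x) = form_u \<alpha> \<tau> \<sigma> \<phi> u z + form_u \<alpha> \<tau> \<sigma> \<phi> u z'"
  unfolding form_u_def rot_add[OF z] divergence_add[OF z] inner_add_left
  using poly_sq_int(1)[OF \<sigma>] poly_sq_int(1)[OF \<phi>] poly_sq_int(5,6)[OF z(1)] poly_sq_int(5,6)[OF z(2)]
    poly_boundary_L2(1)[OF \<sigma>] poly_boundary_L2(1)[OF \<phi>] poly_boundary_L2(2,3)[OF u]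
    poly_boundary_L2(2,3)[OF z(1)] poly_boundary_L2(2,3)[OF z(2)]
  by (simp add: L2_inner_add_right L2_boundary_inner_add_right algebra_simps)

lemma form_u_scale:
  "form_u \<alpha> \<tau> (\<lambda>x. a * \<sigma> x) (\<lambda>x. a * \<phi> x) (\<lambda>x. a *\<^sub>R u x) z = a * form_u \<alpha> \<tau> \<sigma> \<phi> u z"
  "z \<in> vec_poly_space k \<Longrightarrow> form_u \<alpha> \<tau> \<sigma> \<phi> u (\<lambda>x. a *\<^sub>R z x) = a * form_u \<alpha> \<tau> \<sigma> \<phi> u z"
  by (simp_all add: form_u_def rot_scaleR divergence_scaleR L2_inner_cmult L2_boundary_inner_cmult algebra_simps)

lemma load_u_add:
  assumes f: "L2_fun K f" and uc: "L2_boundary_fun vs uc" and uh: "L2_boundary_fun vs uh"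
    and z: "z \<in> vec_poly_space k" "z' \<in> vec_poly_space k"
  shows "load_u \<alpha> \<tau> f uc uh (\<lambda>x. z x + z' x) = load_u \<alpha> \<tau> f uc uh z + load_u \<alpha> \<tau> f uc uh z'"
proof -
  have "sq_int (lebesgue_on K) f" using f by (simp add: L2_fun_def sq_int_def)
  then show ?thesis
    unfolding load_u_def inner_add_left
    using poly_sq_int(4)[OF z(1)] poly_sq_int(4)[OF z(2)]
      poly_boundary_L2(2,3)[OF z(1)] poly_boundary_L2(2,3)[OF z(2)]
      boundary_L2_normal[OF uc] boundary_L2_normal[OF uh]
    by (simp add: L2_inner_add_right L2_boundary_inner_add_right algebra_simps)
qed

lemma load_u_scale: "load_u \<alpha> \<tau> f uc uh (\<lambda>x. a *\<^sub>R z x) = a * load_u \<alpha> \<tau> f uc uh z"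
  by (simp add: load_u_def L2_inner_scaleR L2_boundary_inner_cmult algebra_simps)

lemma third_equation_iff:
  assumes "L2_boundary_fun vs uc" "L2_boundary_fun vs uh"
    and \<sigma>: "\<sigma> \<in> poly_space k" and \<phi>: "\<phi> \<in> poly_space k" and u: "u \<in> vec_poly_space k" and z: "z \<in> vec_poly_space k"
  shows "L2_inner K \<sigma> (rot z)
        + L2_boundary_inner vs (\<lambda>x. \<sigma> x + inverse \<alpha> * ((u x - uc x) \<bullet> perp (n x))) (\<lambda>x. z x \<bullet> perp (n x))
        - L2_inner K \<phi> (divergence z)
        + L2_boundary_inner vs (\<lambda>x. \<phi> x + inverse \<tau> * ((u x - uh x) \<bullet> n x)) (\<lambda>x. z x \<bullet> n x)
        = L2_inner K f z \<longleftrightarrow> form_u \<alpha> \<tau> \<sigma> \<phi> u z = load_u \<alpha> \<tau> f uc uh z"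
proof -
  have split: "L2_boundary_inner vs (\<lambda>x. p x + c * (q x - r x)) m
      = L2_boundary_inner vs p m + c * L2_boundary_inner vs q m - c * L2_boundary_inner vs r m"
    if "boundary_L2 vs p" "boundary_L2 vs q" "boundary_L2 vs r" "boundary_L2 vs m" for p q r m c
  proof -
    have "L2_boundary_inner vs (\<lambda>x. p x + (c * q x + (- c) * r x)) m
        = L2_boundary_inner vs p m + L2_boundary_inner vs (\<lambda>x. c * q x + (- c) * r x) m"
      by (intro L2_boundary_inner_add_left boundary_L2_add boundary_L2_cmult that)
    also have "L2_boundary_inner vs (\<lambda>x. c * q x + (- c) * r x) m
        = L2_boundary_inner vs (\<lambda>x. c * q x) m + L2_boundary_inner vs (\<lambda>x. (- c) * r x) m"
      by (intro L2_boundary_inner_add_left boundary_L2_cmult that)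
    finally show ?thesis
      by (simp only: L2_boundary_inner_cmult) (simp add: algebra_simps)
  qed
  show ?thesis
    unfolding inner_diff_left form_u_def load_u_def
    by (subst (1 2) split)
       (auto intro: poly_boundary_L2 boundary_L2_normal \<sigma> \<phi> u z assms(1,2))
qed

lemma forms_zero:
  "form_sigma \<sigma> u (\<lambda>x. 0) = 0" "form_phi \<phi> u (\<lambda>x. 0) = 0" "form_u \<alpha> \<tau> \<sigma> \<phi> u (\<lambda>x. 0) = 0"
  "load_u \<alpha> \<tau> f uc uh (\<lambda>x. 0) = 0" "L2_boundary_inner vs g (\<lambda>x. 0) = 0"
  by (simp_all add: form_sigma_def form_phi_def form_u_def load_u_def L2_inner_def L2_boundary_inner_def
      curl_def grad_def rot_def divergence_def inner_2 vector_2)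

text \<open>The three equations are merged into the single variational equation
  \<open>A w y = L y\<close>. Nothing is lost, since the three test functions are independent and
  each can be isolated by setting the others to zero.\<close>

lemma local_problem_unique_solution:
  assumes pos: "\<alpha> > 0" "\<tau> > 0"
    and f: "L2_fun K f" and uc: "L2_boundary_fun vs uc" and uh: "L2_boundary_fun vs uh"
  shows "\<exists>!(\<sigma>, \<phi>, u). (\<sigma>, \<phi>, u) \<in> poly_space k \<times> poly_space k \<times> vec_poly_space k \<and>
    (\<forall>\<eta> \<in> poly_space k. \<forall>\<psi> \<in> poly_space k. \<forall>z \<in> vec_poly_space k.
      form_sigma \<sigma> u \<eta> + L2_boundary_inner vs (\<lambda>x. uc x \<bullet> perp (n x)) \<eta> = 0 \<and>
      form_phi \<phi> u \<psi> + L2_boundary_inner vs (\<lambda>x. uh x \<bullet> n x) \<psi> = 0 \<and>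
      form_u \<alpha> \<tau> \<sigma> \<phi> u z = load_u \<alpha> \<tau> f uc uh z)"
proof -
  let ?s = "\<lambda>w x. fst (w x)" and ?p = "\<lambda>w x. fst (snd (w x))" and ?v = "\<lambda>w x. snd (snd (w x))"
  let ?uc = "\<lambda>x. uc x \<bullet> perp (n x)" and ?uh = "\<lambda>x. uh x \<bullet> n x"
  define A where "A = (\<lambda>(w :: real^2 \<Rightarrow> real \<times> real \<times> (real^2)) y.
    form_sigma (?s w) (?v w) (?s y) + form_phi (?p w) (?v w) (?p y) + form_u \<alpha> \<tau> (?s w) (?p w) (?v w) (?v y))"
  define L where "L = (\<lambda>(y :: real^2 \<Rightarrow> real \<times> real \<times> (real^2)).
    load_u \<alpha> \<tau> f uc uh (?v y) - L2_boundary_inner vs ?uc (?s y) - L2_boundary_inner vs ?uh (?p y))"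
  note mem = poly_fields_triple
  have A1: "linear_form_on (poly_fields k) (\<lambda>w. A w y)" if "y \<in> poly_fields k" for y
    using that unfolding linear_form_on_def A_def mem
    by (auto simp: mem form_sigma_add_left[where k = k] form_phi_add_left[where k = k] form_u_add_left[where k = k]
        form_sigma_scale form_phi_scale form_u_scale distrib_left)
  have A2: "linear_form_on (poly_fields k) (A w)" if "w \<in> poly_fields k" for w
    using that unfolding linear_form_on_def A_def mem
    by (auto simp: mem form_sigma_add_right[where k = k] form_phi_add_right[where k = k] form_u_add_right[where k = k]
        form_sigma_scale form_phi_scale form_u_scale distrib_left)
  have L: "linear_form_on (poly_fields k) L"
    unfolding linear_form_on_def L_def mem
    by (auto simp: mem load_u_add[OF f uc uh, where k = k] load_u_scale L2_boundary_inner_add_right L2_boundary_inner_cmult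
        boundary_L2_normal[OF uc] boundary_L2_normal[OF uh] poly_boundary_L2 right_diff_distrib)
  \<comment> \<open>The factor \<open>c\<close> covers two cases at once: \<open>c = 1\<close> is
    the given problem, \<open>c = 0\<close> the homogeneous one.\<close>
  have system: "(\<forall>\<eta> \<in> poly_space k. \<forall>\<psi> \<in> poly_space k. \<forall>z \<in> vec_poly_space k.
      form_sigma (?s w) (?v w) \<eta> + c * L2_boundary_inner vs ?uc \<eta> = 0 \<and>
      form_phi (?p w) (?v w) \<psi> + c * L2_boundary_inner vs ?uh \<psi> = 0 \<and>
      form_u \<alpha> \<tau> (?s w) (?p w) (?v w) z = c * load_u \<alpha> \<tau> f uc uh z)
     \<longleftrightarrow> (\<forall>y\<in>poly_fields k. A w y = c * L y)" (is "?L \<longleftrightarrow> ?R") for w c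
  proof
    assume ?L
    then show ?R unfolding A_def L_def by (auto simp: mem right_diff_distrib) (smt (verit) poly_space_zero)
  next
    assume R: ?R
    have R': "form_sigma (?s w) (?v w) \<eta> + form_phi (?p w) (?v w) \<psi> + form_u \<alpha> \<tau> (?s w) (?p w) (?v w) z
      = c * (load_u \<alpha> \<tau> f uc uh z - L2_boundary_inner vs ?uc \<eta> - L2_boundary_inner vs ?uh \<psi>)"
      if "\<eta> \<in> poly_space k" "\<psi> \<in> poly_space k" "z \<in> vec_poly_space k" for \<eta> \<psi> z
      using bspec[OF R, of "\<lambda>x. (\<eta> x, \<psi> x, z x)"] that unfolding A_def L_def mem by simp
    show ?L
    proof (intro ballI conjI)
      fix \<eta> \<psi> z assume "\<eta> \<in> poly_space k" "\<psi> \<in> poly_space k" "z \<in> vec_poly_space k"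
      then show "form_sigma (?s w) (?v w) \<eta> + c * L2_boundary_inner vs ?uc \<eta> = 0"
        "form_phi (?p w) (?v w) \<psi> + c * L2_boundary_inner vs ?uh \<psi> = 0"
        "form_u \<alpha> \<tau> (?s w) (?p w) (?v w) z = c * load_u \<alpha> \<tau> f uc uh z"
        using R'[OF _ poly_space_zero vec_poly_zero, of \<eta>] R'[OF poly_space_zero _ vec_poly_zero, of \<psi>]
          R'[OF poly_space_zero poly_space_zero, of z]
        by (simp_all add: forms_zero)
    qed
  qed
  have inj: "w = (\<lambda>x. 0)" if w: "w \<in> poly_fields k" and 0: "\<And>y. y \<in> poly_fields k \<Longrightarrow> A w y = 0" for w
  proof
    fix x
    have c: "?s w \<in> poly_space k" "?p w \<in> poly_space k" "?v w \<in> vec_poly_space k"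
      using w unfolding mem by simp_all
    have "\<forall>y\<in>poly_fields k. A w y = 0 * L y" using 0 by simp
    then have H: "form_sigma (?s w) (?v w) \<eta> = 0" "form_phi (?p w) (?v w) \<psi> = 0"
      "form_u \<alpha> \<tau> (?s w) (?p w) (?v w) z = 0"
      if "\<eta> \<in> poly_space k" "\<psi> \<in> poly_space k" "z \<in> vec_poly_space k" for \<eta> \<psi> z
      unfolding system[symmetric] using that by auto
    have "?s w x = 0 \<and> ?p w x = 0 \<and> ?v w x = 0"
      using H(1)[OF _ poly_space_zero vec_poly_zero] H(2)[OF poly_space_zero _ vec_poly_zero]
        H(3)[OF poly_space_zero poly_space_zero]
      by (intro homogeneous_zero[OF pos c])
    then show "w x = 0" by (simp add: prod_eq_iff)
  qed
  obtain w where w: "w \<in> poly_fields k" "\<forall>y\<in>poly_fields k. A w y = L y"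
  proof -
    have "\<exists>w\<in>poly_fields k. \<forall>y\<in>poly_fields k. A w y = L y"
      by (rule poly_variational_solvable[OF A1 A2 L]) (auto dest: inj)
    then show ?thesis using that by blast
  qed
  have unique: "w' = w" if w': "w' \<in> poly_fields k" "\<forall>y\<in>poly_fields k. A w' y = L y" for w'
  proof
    fix x
    let ?d = "\<lambda>x. w' x + (- 1) *\<^sub>R w x"
    have m: "(\<lambda>x. (- 1) *\<^sub>R w x) \<in> poly_fields k" by (rule poly_fields_scaleR[OF w(1)])
    have d: "?d \<in> poly_fields k" by (rule poly_fields_add[OF w'(1) m])
    have "A ?d y = 0" if y: "y \<in> poly_fields k" for y
      using linear_form_on_add[OF A1[OF y] w'(1) m] linear_form_on_scaleR[OF A1[OF y] w(1), of "- 1"]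
        w(2) w'(2) y by simp
    then have "?d = (\<lambda>x. 0)" by (rule inj[OF d])
    from fun_cong[OF this, of x] show "w' x = w x" by simp
  qed
  show ?thesis
  proof (rule ex1I[of _ "(?s w, ?p w, ?v w)"], goal_cases)
    case 1
    show ?case using w system[of w 1] unfolding mem by auto
  next
    case (2 t)
    obtain \<sigma> \<phi> u where t: "t = (\<sigma>, \<phi>, u)" by (cases t)
    have "(\<lambda>x. (\<sigma> x, \<phi> x, u x)) = w"
      using 2 system[of "\<lambda>x. (\<sigma> x, \<phi> x, u x)" 1] unfolding t
      by (intro unique) (auto simp: mem)
    then show ?case unfolding t by auto
  qed
qed

end

theorem theorem2:
  fixes \<Omega> K :: "(real^2) set" and T :: "(real^2) set set"
    and vs :: "(real^2) list"
    and h \<rho> \<alpha> \<tau> :: real and k :: nat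
    and f uc uh :: "real^2 \<Rightarrow> real^2"
  assumes "admissible_domain \<Omega>"
    and "\<rho> > 0"
    and "quasi_uniform_mesh \<Omega> T h \<rho>"
    and "K \<in> T"
    and "polygon_with_vertices vs K"
    and "\<alpha> > 0" and "\<tau> > 0"
    and "L2_fun K f"
    and "L2_boundary_fun vs uc"
    and "L2_boundary_fun vs uh"
  shows "\<exists>!(\<sigma>, \<phi>, u). (\<sigma>, \<phi>, u) \<in> poly_space k \<times> poly_space k \<times> vec_poly_space k \<and>
    (let n = outward_normal K;
         \<sigma>c = (\<lambda>x. \<sigma> x + inverse \<alpha> * ((u x - uc x) \<bullet> perp (n x)));
         \<phi>h = (\<lambda>x. \<phi> x + inverse \<tau> * ((u x - uh x) \<bullet> n x))
     in \<forall>\<eta> \<in> poly_space k. \<forall>\<psi> \<in> poly_space k. \<forall>z \<in> vec_poly_space k.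
       L2_inner K \<sigma> \<eta> - L2_inner K u (curl \<eta>)
         + L2_boundary_inner vs (\<lambda>x. uc x \<bullet> perp (n x)) \<eta> = 0 \<and>
       L2_inner K \<phi> \<psi> - L2_inner K u (grad \<psi>)
         + L2_boundary_inner vs (\<lambda>x. uh x \<bullet> n x) \<psi> = 0 \<and>
       L2_inner K \<sigma> (rot z) + L2_boundary_inner vs \<sigma>c (\<lambda>x. z x \<bullet> perp (n x))
         - L2_inner K \<phi> (divergence z) + L2_boundary_inner vs \<phi>h (\<lambda>x. z x \<bullet> n x)
         = L2_inner K f z)"
proof -
  interpret polygonal_element vs K
    by (rule polygonal_element_of_mesh(1)[OF assms(3,2,4,5)])
  obtain c r where "r > 0" "\<And>c'. c' \<in> ball c r \<Longrightarrow> star_centre K c'"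
    using polygonal_element_of_mesh(2)[OF assms(3,2,4,5)] by blast
  then interpret star_element vs K c r
    by unfold_locales
  \<comment> \<open>The equivalence holds only for polynomial arguments, so it is used below as a
    conditional rewrite rule, with congruence rules that supply the memberships.\<close>
  have third: "(L2_inner K \<sigma> (rot z)
        + L2_boundary_inner vs (\<lambda>x. \<sigma> x + inverse \<alpha> * ((u x - uc x) \<bullet> perp (n x))) (\<lambda>x. z x \<bullet> perp (n x))
        - L2_inner K \<phi> (divergence z)
        + L2_boundary_inner vs (\<lambda>x. \<phi> x + inverse \<tau> * ((u x - uh x) \<bullet> n x)) (\<lambda>x. z x \<bullet> n x)
        = L2_inner K f z) = (form_u \<alpha> \<tau> \<sigma> \<phi> u z = load_u \<alpha> \<tau> f uc uh z)"
    if "(\<sigma>, \<phi>, u) \<in> poly_space k \<times> poly_space k \<times> vec_poly_space k" "z \<in> vec_poly_space k" for \<sigma> \<phi> u z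
    using that by (intro third_equation_iff[OF assms(9,10), of _ k]) auto
  show ?thesis
    using local_problem_unique_solution[OF assms(6-10), of k]
    unfolding Let_def form_sigma_def[symmetric] form_phi_def[symmetric]
    by (simp only: third cong: conj_cong ball_cong)
qed

end
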